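(* Let $u\in\mathbb R^n$. Assume that the feasible map $\mathcal F$ is RCR-regular at each $(\bar x,y)\in\mathrm{gph}\,S$. Suppose that the restricted inf-compactness holds at $\bar x$ in direction $u$ and that RS is satisfied at each $(\bar x,y)\in\mathrm{gph}\,S$ in direction $u$. Then the value function $V$ is directionally differentiable at $\bar x$ in direction $u$ and $$V'(\bar x;u)=\min_{y\in S(\bar x;u)}\ \min_{v\in\mathbb L(\bar x,y;u)}\nabla f(\bar x,y)(u,v)=\min_{y\in S(\bar x;u)}\ \max_{\lambda\in\Lambda(\bar x,y)}\nabla_x\mathcal L(\bar x,y;\lambda)u.$$
   Context: Let $f:\mathbb R^n\times\mathbb R^m\to\mathbb R$ and $g:\mathbb R^n\times\mathbb R^m\to\mathbb R^p$ be continuously differentiable. Consider the parametric problem $(P_x)$: $\min_y f(x,y)$ s.t. $g(x,y)\le0$. Feasible map: $\mathcal F(x)=\{y:g(x,y)\le0\}$; value function $V(x)=\inf\{f(x,y):y\in\mathcal F(x)\}$; solution map $S(x)$ = set of optimal solutions of $(P_x)$; $\mathrm{gph}$ denotes the graph. $I_g(x,y)=\{i:g_i(x,y)=0\}$; $\mathcal L(x,y;\lambda)=f(x,y)+g(x,y)^T\lambda$; $\Lambda(x,y)=\{\lambda\in\mathbb R^p:\nabla_y\mathcal L(x,y;\lambda)=0,\ g(x,y)^T\lambda=0,\ \lambda\ge0\}$; $\mathbb L(\bar x,y;u)=\{v\in\mathbb R^m:\nabla g_i(\bar x,y)(u,v)\le0\ \forall i\in I_g(\bar x,y)\}$. $\mathbb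 B$ is the open unit ball, $\mathbb B_\epsilon(\bar y)$ the open ball of radius $\epsilon$ about $\bar y$. For a direction $d$ and $\epsilon,\delta>0$: $\mathcal V_{\epsilon,\delta}(d):=\{z\in\epsilon\mathbb B : \big\|\,\|d\|z-\|z\|d\,\big\|\le\delta\|z\|\|d\|\}$. Directional derivative: $V'(\bar x;u)=\lim_{t\downarrow0}(V(\bar x+tu)-V(\bar x))/t$; $V$ is directionally differentiable at $\bar x$ in direction $u$ if this limit exists. Directional solution set: $S(\bar x;u)=\{y\in S(\bar x):\exists t_k\downarrow0,u^k\to u,y^k\to y,\ y^k\in S(\bar x+t_ku^k)\}$. RCR regularity of $\mathcal F$ at $(\bar x,\bar y)\in\mathrm{gph}\,\mathcal F$: there is $\delta>0$ such that for any $K\subseteq I_g(\bar x,\bar y)$ the family $\{\nabla_yg_j(x,y)\}_{j\in K}$ has the same rank at all $(x,y)\in\mathbb B_\delta(\bar x,\bar y)$. Robinson stability (RS) of $\mathcal F$ at $(\bar x,\bar y)\in\mathrm{gph}\,\mathcal F$ in direction $u$: there are $\kappa,\epsilon,\delta>0$ with $\mathrm{dist}(y,\mathcal F(x))\le\kappa\|g_+(x,y)\|$ for all $x\in\bar x+\mathcal V_{\epsilon,\delta}(u)$, $y\in\mathbb B_\epsilon(\bar y)$, where $g_+=\max\{0,g\}$ componentwise. Restricted inf-compactness at $\bar x$ in direction $u$ (with compact set $\Omega_u\subseteq\mathbb R^m$): $V(\bar x)$ is finite and there are $\epsilon,\delta>0$ such that for all $x\in\bar x+\mathcal V_{\epsilon,\delta}(u)$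 with $V(x)<V(\bar x)+\epsilon$ one has $S(x)\cap\Omega_u\ne\emptyset$. It holds in direction $u$ if it holds with some compact $\Omega_u$. *)

theory Defs
  imports "HOL-Analysis.Analysis"
begin

definition cont_diff :: "('a::real_normed_vector \<Rightarrow> 'b::real_normed_vector) \<Rightarrow> bool"
  where "cont_diff h \<longleftrightarrow>
    (\<exists>h'. (\<forall>z. (h has_derivative blinfun_apply (h' z)) (at z)) \<and> continuous_on UNIV h')"

text \<open>Meaningful only where \<open>h\<close> is differentiable, as everywhere below. Partial gradients
  are gradients of the corresponding section of the function.\<close>

definition gradient :: "('a::euclidean_space \<Rightarrow> real) \<Rightarrow> 'a \<Rightarrow> 'a"
  where "gradient h z = (THE D. GDERIV h z :> D)"

lemma gradient_eqI:
  assumes "GDERIV h z :> D"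
  shows "gradient h z = D"
  unfolding gradient_def
proof (rule the_equality)
  show "GDERIV h z :> D" by fact
  fix E assume "GDERIV h z :> E"
  with assms have "(\<lambda>v. v \<bullet> E) = (\<lambda>v. v \<bullet> D)"
    unfolding gderiv_def by (rule has_derivative_unique[rotated])
  then show "E = D"
    by (metis inner_commute vector_eq_rdot)
qed

definition feas_map :: "((real^'n) \<times> (real^'m) \<Rightarrow> real^'p) \<Rightarrow> real^'n \<Rightarrow> (real^'m) set"
  where "feas_map g x = {y. \<forall>i. g (x, y) $ i \<le> 0}"

text \<open>Extended-real valued: \<open>\<infinity>\<close> if the problem is infeasible, \<open>-\<infinity>\<close> if it is unbounded.\<close>

definition value_fun ::
  "((real^'n) \<times> (real^'m) \<Rightarrow> real) \<Rightarrow> ((real^'n) \<times> (real^'m) \<Rightarrow> real^'p) \<Rightarrow> real^'n \<Rightarrow> ereal"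
  where "value_fun f g x = (INF y\<in>feas_map g x. ereal (f (x, y)))"

definition sol_map ::
  "((real^'n) \<times> (real^'m) \<Rightarrow> real) \<Rightarrow> ((real^'n) \<times> (real^'m) \<Rightarrow> real^'p) \<Rightarrow> real^'n \<Rightarrow> (real^'m) set"
  where "sol_map f g x = {y \<in> feas_map g x. \<forall>y'\<in>feas_map g x. f (x, y) \<le> f (x, y')}"

definition dir_sol_set ::
  "((real^'n) \<times> (real^'m) \<Rightarrow> real) \<Rightarrow> ((real^'n) \<times> (real^'m) \<Rightarrow> real^'p)
    \<Rightarrow> real^'n \<Rightarrow> real^'n \<Rightarrow> (real^'m) set"
  where "dir_sol_set f g x u =
    {y \<in> sol_map f g x. \<exists>t uk yk. (\<forall>k::nat. 0 < t k) \<and> t \<longlonglongrightarrow> 0 \<and> uk \<longlonglongrightarrow> u \<and> yk \<longlonglongrightarrow> y \<and>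
      (\<forall>k. yk k \<in> sol_map f g (x + t k *\<^sub>R uk k))}"

definition active_set :: "((real^'n) \<times> (real^'m) \<Rightarrow> real^'p) \<Rightarrow> real^'n \<Rightarrow> real^'m \<Rightarrow> 'p set"
  where "active_set g x y = {i. g (x, y) $ i = 0}"

definition lagrangian ::
  "((real^'n) \<times> (real^'m) \<Rightarrow> real) \<Rightarrow> ((real^'n) \<times> (real^'m) \<Rightarrow> real^'p)
    \<Rightarrow> real^'n \<Rightarrow> real^'m \<Rightarrow> real^'p \<Rightarrow> real"
  where "lagrangian f g x y l = f (x, y) + g (x, y) \<bullet> l"

definition multipliers ::
  "((real^'n) \<times> (real^'m) \<Rightarrow> real) \<Rightarrow> ((real^'n) \<times> (real^'m) \<Rightarrow> real^'p)
    \<Rightarrow> real^'n \<Rightarrow> real^'m \<Rightarrow> (real^'p) set"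
  where "multipliers f g x y =
    {l. gradient (\<lambda>y'. lagrangian f g x y' l) y = 0 \<and> g (x, y) \<bullet> l = 0 \<and> (\<forall>i. 0 \<le> l $ i)}"

definition lin_cone ::
  "((real^'n) \<times> (real^'m) \<Rightarrow> real^'p) \<Rightarrow> real^'n \<Rightarrow> real^'m \<Rightarrow> real^'n \<Rightarrow> (real^'m) set"
  where "lin_cone g x y u =
    {v. \<forall>i\<in>active_set g x y. gradient (\<lambda>z. g z $ i) (x, y) \<bullet> (u, v) \<le> 0}"

definition dir_nbhd :: "real \<Rightarrow> real \<Rightarrow> 'a::real_normed_vector \<Rightarrow> 'a set"
  where "dir_nbhd \<epsilon> \<delta> d =
    {z \<in> ball 0 \<epsilon>. norm (norm d *\<^sub>R z - norm z *\<^sub>R d) \<le> \<delta> * norm z * norm d}"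

text \<open>The rank of a family of vectors is the dimension of the span of its members.\<close>

definition rcr_regular :: "((real^'n) \<times> (real^'m) \<Rightarrow> real^'p) \<Rightarrow> real^'n \<Rightarrow> real^'m \<Rightarrow> bool"
  where "rcr_regular g xb yb \<longleftrightarrow>
    (\<exists>\<delta>>0. \<forall>K\<subseteq>active_set g xb yb. \<exists>r. \<forall>(x, y)\<in>ball (xb, yb) \<delta>.
       dim ((\<lambda>j. gradient (\<lambda>y'. g (x, y') $ j) y) ` K) = r)"

text \<open>Nonemptiness of the feasible set is required explicitly because the distance to the empty
  set is \<open>\<infinity>\<close> in variational analysis, whereas \<open>infdist y {} = 0\<close>.\<close>

definition robinson_stable_dir ::
  "((real^'n) \<times> (real^'m) \<Rightarrow> real^'p) \<Rightarrow> real^'n \<Rightarrow> real^'m \<Rightarrow> real^'n \<Rightarrow> bool"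
  where "robinson_stable_dir g xb yb u \<longleftrightarrow>
    (\<exists>\<kappa>>0. \<exists>\<epsilon>>0. \<exists>\<delta>>0. \<forall>z\<in>dir_nbhd \<epsilon> \<delta> u. \<forall>y\<in>ball yb \<epsilon>.
       feas_map g (xb + z) \<noteq> {} \<and>
       infdist y (feas_map g (xb + z)) \<le> \<kappa> * norm (\<chi> i. max 0 (g (xb + z, y) $ i)))"

definition restricted_inf_compact_dir ::
  "((real^'n) \<times> (real^'m) \<Rightarrow> real) \<Rightarrow> ((real^'n) \<times> (real^'m) \<Rightarrow> real^'p)
    \<Rightarrow> real^'n \<Rightarrow> real^'n \<Rightarrow> bool"
  where "restricted_inf_compact_dir f g xb u \<longleftrightarrow>
    \<bar>value_fun f g xb\<bar> \<noteq> \<infinity> \<and>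
    (\<exists>\<Omega>. compact \<Omega> \<and> (\<exists>\<epsilon>>0. \<exists>\<delta>>0. \<forall>z\<in>dir_nbhd \<epsilon> \<delta> u.
       value_fun f g (xb + z) < value_fun f g xb + ereal \<epsilon> \<longrightarrow>
       sol_map f g (xb + z) \<inter> \<Omega> \<noteq> {}))"

definition has_dir_derivative ::
  "('a::real_normed_vector \<Rightarrow> ereal) \<Rightarrow> real \<Rightarrow> 'a \<Rightarrow> 'a \<Rightarrow> bool"
  where "has_dir_derivative V d x u \<longleftrightarrow>
    ((\<lambda>t::real. (V (x + t *\<^sub>R u) - V x) / ereal t) \<longlongrightarrow> ereal d) (at_right 0)"

text \<open>Attained minima and maxima of possibly infinite sets of reals.\<close>

definition is_minimum :: "real \<Rightarrow> real set \<Rightarrow> bool"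
  where "is_minimum m A \<longleftrightarrow> m \<in> A \<and> (\<forall>a\<in>A. m \<le> a)"

definition is_maximum :: "real \<Rightarrow> real set \<Rightarrow> bool"
  where "is_maximum m A \<longleftrightarrow> m \<in> A \<and> (\<forall>a\<in>A. a \<le> m)"

end

(*
  The upper bound: if v lies in the linearised cone at a solution y, then Robinson stability
  corrects (xb + t u, y + t v) to a feasible point at cost o(t).

  The lower bound: restricted inf-compactness gives solutions y_k at xb + t_k u with y_k -> y in S(xb; u),
  but |y_k - y| may be much larger than t_k. Pass to limits a_i in [-oo, 0] of g_i(xb + t_k u, y_k) / t_k.
  If some v satisfies a_i <= Dg_i(u, v) <= 0 for all active i, then y_k - t_k v is o(t_k)-feasible at xb,
  and Robinson stability with z = 0 compares f(xb + t_k u, y_k) with the optimal value at xb.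
  If no such v exists, then Farkas' lemma together with Caratheodory's theorem gives a certificate
  supported on a circuit of the gradients D_y g_i. By constant rank, this linear dependence persists
  near (xb, y) as a relation between the functions g_i themselves, with coefficients of unchanged
  sign; evaluating it at (xb + t_k u, y_k) contradicts the certificate.

  The equality of the two formulas is linear programming duality.
*)

theory Submission
  imports Defs
begin

subsection \<open>Systems of linear inequalities\<close>

text \<open>The obstacle in the lower bound is that nothing of order \<open>t_k\<close> converges
  when seen from the fixed point y. What converges is the increment from a moving feasible point at
  \<open>xb\<close>, so derivatives are used in the strict sense. Limits of the quotients may be
  infinite; such indices can occur in a certificate only with positive coefficients, and those terms
  are discarded by sign. A circuit is required because its dependence is unique up to a factor: only
  then do the coefficients at nearby points converge to the given ones. The derivative
  \<open>d\<close> is read off along a single sequence as Df(u, v0). Comparison with the upper bound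
  at all solutions and all cone directions makes it minimal, and this minimality bounds every
  linearised problem from below. Multipliers therefore come from linear programming duality, with no
  separate optimality theorem. Points of S(xb; u) may arise from directions tending to u; the
  increment argument admits such moving directions, so that the linearised cone is nonempty at each
  of these points.\<close>

lemma span_family:
  fixes w :: "'i \<Rightarrow> 'a::real_vector"
  assumes "finite T" "x \<in> span (w ` T)"
  obtains c where "x = (\<Sum>i\<in>T. c i *\<^sub>R w i)"
proof -
  have "span (w ` T) \<subseteq> range (\<lambda>c. \<Sum>i\<in>T. c i *\<^sub>R w i)"
  proof (rule span_minimal)
    show "w ` T \<subseteq> range (\<lambda>c. \<Sum>i\<in>T. c i *\<^sub>R w i)"
    proof
      fix x assume "x \<in> w ` T"
      then obtain j where j: "j \<in> T" "x = w j" by auto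
      have "(\<Sum>i\<in>T. (if i = j then 1 else 0) *\<^sub>R w i) = (\<Sum>i\<in>T. if i = j then w i else 0)"
        by (rule sum.cong) auto
      also have "\<dots> = x" using j assms(1) by simp
      finally show "x \<in> range (\<lambda>c. \<Sum>i\<in>T. c i *\<^sub>R w i)"
        by (intro range_eqI[of _ _ "\<lambda>i. if i = j then 1 else 0"]) simp
    qed
    show "subspace (range (\<lambda>c. \<Sum>i\<in>T. c i *\<^sub>R w i))"
    proof (rule subspaceI)
      show "0 \<in> range (\<lambda>c. \<Sum>i\<in>T. c i *\<^sub>R w i)"
        by (rule range_eqI[of _ _ "\<lambda>_. 0"]) simp
    next
      fix x y assume "x \<in> range (\<lambda>c. \<Sum>i\<in>T. c i *\<^sub>R w i)" "y \<in> range (\<lambda>c. \<Sum>i\<in>T. c i *\<^sub>R w i)"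
      then obtain c d where "x = (\<Sum>i\<in>T. c i *\<^sub>R w i)" "y = (\<Sum>i\<in>T. d i *\<^sub>R w i)" by auto
      then show "x + y \<in> range (\<lambda>c. \<Sum>i\<in>T. c i *\<^sub>R w i)"
        by (intro range_eqI[of _ _ "\<lambda>i. c i + d i"]) (simp add: scaleR_add_left sum.distrib)
    next
      fix a x assume "x \<in> range (\<lambda>c. \<Sum>i\<in>T. c i *\<^sub>R w i)"
      then obtain c where "x = (\<Sum>i\<in>T. c i *\<^sub>R w i)" by auto
      then show "a *\<^sub>R x \<in> range (\<lambda>c. \<Sum>i\<in>T. c i *\<^sub>R w i)"
        by (intro range_eqI[of _ _ "\<lambda>i. a * c i"]) (simp add: scaleR_sum_right)
    qed
  qed
  with assms(2) that show ?thesis by blast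
qed

text \<open>A finitely generated cone is closed, so a vector outside it is strictly separated from
  it; the separating normal, negated, satisfies every inequality on the generators but has positive
  product with \<open>b\<close>.\<close>

lemma farkas:
  fixes w :: "'i \<Rightarrow> 'a::euclidean_space"
  assumes "finite T" and "\<And>v. (\<And>i. i \<in> T \<Longrightarrow> w i \<bullet> v \<le> 0) \<Longrightarrow> b \<bullet> v \<le> 0"
  obtains l where "\<forall>i\<in>T. 0 \<le> l i" "b = (\<Sum>i\<in>T. l i *\<^sub>R w i)"
proof -
  let ?H = "convex_cone hull (w ` T)"
  let ?S = "{x. \<exists>l. (\<forall>i\<in>T. 0 \<le> l i) \<and> x = (\<Sum>i\<in>T. l i *\<^sub>R w i)}"
  have "?H \<subseteq> ?S"
  proof (rule hull_minimal)
    show "w ` T \<subseteq> ?S"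
    proof clarify
      fix j assume j: "j \<in> T"
      have "(\<Sum>i\<in>T. (if i = j then 1 else 0) *\<^sub>R w i) = (\<Sum>i\<in>T. if i = j then w i else 0)"
        by (rule sum.cong) auto
      also have "\<dots> = w j" using j assms(1) by simp
      finally show "\<exists>l. (\<forall>i\<in>T. 0 \<le> l i) \<and> w j = (\<Sum>i\<in>T. l i *\<^sub>R w i)"
        by (intro exI[of _ "\<lambda>i. if i = j then 1 else 0"]) simp
    qed
    show "convex_cone ?S"
      unfolding convex_cone_iff
    proof (intro conjI ballI allI impI)
      show "0 \<in> ?S" by (auto intro!: exI[of _ "\<lambda>_. 0"])
    next
      fix x y assume "x \<in> ?S" "y \<in> ?S"
      then obtain c d where "\<forall>i\<in>T. 0 \<le> c i" "\<forall>i\<in>T. 0 \<le> d i"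
        "x = (\<Sum>i\<in>T. c i *\<^sub>R w i)" "y = (\<Sum>i\<in>T. d i *\<^sub>R w i)" by auto
      then show "x + y \<in> ?S"
        by (auto intro!: exI[of _ "\<lambda>i. c i + d i"] simp: scaleR_add_left sum.distrib)
    next
      fix x and a :: real assume "x \<in> ?S" "0 \<le> a"
      moreover from this obtain c where "\<forall>i\<in>T. 0 \<le> c i" "x = (\<Sum>i\<in>T. c i *\<^sub>R w i)" by auto
      ultimately show "a *\<^sub>R x \<in> ?S"
        by (auto intro!: exI[of _ "\<lambda>i. a * c i"] simp: scaleR_sum_right)
    qed
  qed
  moreover have "b \<in> ?H"
  proof (rule ccontr)
    assume "b \<notin> ?H"
    moreover have "closed ?H" using assms(1) by (simp add: closed_convex_cone_hull)
    ultimately obtain a \<beta> where ab: "a \<bullet> b < \<beta>" "\<And>x. x \<in> ?H \<Longrightarrow> a \<bullet> x > \<beta>"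
      using separating_hyperplane_closed_point[OF convex_convex_cone_hull, of "w ` T" b] by blast
    have "\<beta> < 0" using ab(2)[OF convex_cone_hull_contains_0] by simp
    have "w i \<bullet> (- a) \<le> 0" if "i \<in> T" for i
    proof (rule ccontr)
      assume "\<not> w i \<bullet> (- a) \<le> 0"
      then have neg: "a \<bullet> w i < 0" by (simp add: inner_commute)
      \<comment> \<open>This multiple of \<open>w i\<close> lies exactly on the hyperplane that the
        cone strictly avoids.\<close>
      have "(\<beta> / (a \<bullet> w i)) *\<^sub>R w i \<in> ?H"
        using that neg \<open>\<beta> < 0\<close> by (intro convex_cone_hull_mul hull_inc) (auto simp: divide_nonpos_neg)
      from ab(2)[OF this] neg show False by simp
    qed
    from assms(2)[OF this] ab(1) \<open>\<beta> < 0\<close> show False by (simp add: inner_commute)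
  qed
  ultimately show ?thesis using that by blast
qed

text \<open>A nonnegative representation on an index set of least cardinality has no zero
  coefficient and no dependence on its support, since a dependence could be used to eliminate an
  index.\<close>

lemma conic_caratheodory:
  fixes w :: "'i \<Rightarrow> 'a::real_vector"
  assumes "finite T" and "\<And>i. i \<in> T \<Longrightarrow> 0 \<le> l i"
  obtains T' l' where "T' \<subseteq> T" "\<forall>i\<in>T'. 0 < l' i"
    "(\<Sum>i\<in>T'. l' i *\<^sub>R w i) = (\<Sum>i\<in>T. l i *\<^sub>R w i)"
    "\<forall>c. (\<Sum>i\<in>T'. c i *\<^sub>R w i) = 0 \<longrightarrow> (\<forall>i\<in>T'. c i = 0)"
proof -
  let ?b = "\<Sum>i\<in>T. l i *\<^sub>R w i"
  define P where "P = (\<lambda>S. S \<subseteq> T \<and> (\<exists>m. (\<forall>i\<in>S. 0 \<le> m i) \<and> (\<Sum>i\<in>S. m i *\<^sub>R w i) = ?b))"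
  have "P T" unfolding P_def using assms(2) by blast
  then obtain S where S: "P S" "\<And>S'. P S' \<Longrightarrow> card S \<le> card S'"
    using ex_has_least_nat[of P T card] by blast
  then obtain m where m: "\<And>i. i \<in> S \<Longrightarrow> 0 \<le> m i" "(\<Sum>i\<in>S. m i *\<^sub>R w i) = ?b" and "S \<subseteq> T"
    unfolding P_def by auto
  have fS: "finite S" using \<open>S \<subseteq> T\<close> assms(1) finite_subset by blast
  have min: "m' i \<noteq> 0"
    if "\<And>i. i \<in> S \<Longrightarrow> 0 \<le> m' i" "(\<Sum>i\<in>S. m' i *\<^sub>R w i) = ?b" "i \<in> S" for m' i
  proof
    assume "m' i = 0"
    then have "(\<Sum>j\<in>S - {i}. m' j *\<^sub>R w j) = ?b"
      using that(2,3) fS by (simp add: sum.remove)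
    then have "P (S - {i})" unfolding P_def using that(1) \<open>S \<subseteq> T\<close> by blast
    then have "card S \<le> card (S - {i})" by (rule S(2))
    then show False using card_Diff1_less[OF fS that(3)] by linarith
  qed
  have indep_pos: "\<not> (\<exists>i\<in>S. 0 < c i)" if c: "(\<Sum>i\<in>S. c i *\<^sub>R w i) = 0" for c
  proof
    assume "\<exists>i\<in>S. 0 < c i"
    then have ne: "{i\<in>S. 0 < c i} \<noteq> {}" by auto
    have fin: "finite {i\<in>S. 0 < c i}" using fS by simp
    obtain i where i: "i \<in> S" "0 < c i" and imin: "\<And>j. j \<in> S \<Longrightarrow> 0 < c j \<Longrightarrow> m i / c i \<le> m j / c j"
      using ex_is_arg_min_if_finite[OF fin ne, of "\<lambda>j. m j / c j"]
      unfolding is_arg_min_linorder by auto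
    \<comment> \<open>The smallest ratio over the positive \<open>c j\<close> is the largest step
      that keeps all coefficients nonnegative, and it brings the coefficient of \<open>i\<close> to
      zero.\<close>
    define s where "s = m i / c i"
    have s: "0 \<le> s" using i m(1) by (simp add: s_def)
    have "0 \<le> m j - s * c j" if "j \<in> S" for j
    proof (cases "0 < c j")
      case True
      then show ?thesis using imin[OF that True] by (simp add: s_def pos_le_divide_eq)
    next
      case False
      then have "s * c j \<le> 0" using s by (simp add: mult_nonneg_nonpos)
      then show ?thesis using m(1)[OF that] by linarith
    qed
    moreover have "(\<Sum>j\<in>S. (m j - s * c j) *\<^sub>R w j) = ?b - s *\<^sub>R (\<Sum>j\<in>S. c j *\<^sub>R w j)"
      by (simp add: scaleR_diff_left sum_subtractf scaleR_sum_right m(2))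
    ultimately have "m i - s * c i \<noteq> 0" using c i by (intro min) auto
    then show False using i by (simp add: s_def)
  qed
  show ?thesis
  proof
    show "S \<subseteq> T" by fact
    have "0 < m i" if "i \<in> S" for i using m(1)[OF that] min[OF m that] by linarith
    then show "\<forall>i\<in>S. 0 < m i" by blast
    show "(\<Sum>i\<in>S. m i *\<^sub>R w i) = ?b" by fact
    show "\<forall>c. (\<Sum>i\<in>S. c i *\<^sub>R w i) = 0 \<longrightarrow> (\<forall>i\<in>S. c i = 0)"
    proof (intro allI impI ballI)
      fix c i assume c: "(\<Sum>i\<in>S. c i *\<^sub>R w i) = 0" and i: "i \<in> S"
      have "(\<Sum>i\<in>S. (- c i) *\<^sub>R w i) = 0" using c by (simp add: sum_negf)
      from indep_pos[OF this] indep_pos[OF c] i show "c i = 0"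
        by (meson linorder_neqE_linordered_idom neg_0_less_iff_less)
    qed
  qed
qed

text \<open>Homogenisation: a solution \<open>(x, s)\<close> of the homogeneous system with rows
  \<open>(b i, r i)\<close> and \<open>s < 0\<close> would rescale to a solution of the excluded
  system, so Farkas' lemma applies to the target \<open>(0, -1)\<close>.\<close>

lemma infeasible_certificate:
  fixes b :: "'i \<Rightarrow> 'a::euclidean_space"
  assumes "finite T" and "\<And>v. \<exists>i\<in>T. r i < b i \<bullet> v"
  obtains l where "\<forall>i\<in>T. 0 \<le> l i" "(\<Sum>i\<in>T. l i *\<^sub>R (b i, r i)) = (0, -1)"
proof -
  have "(0, -1) \<bullet> v \<le> 0" if le: "\<And>i. i \<in> T \<Longrightarrow> (b i, r i) \<bullet> v \<le> 0" for v :: "'a \<times> real"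
  proof (rule ccontr)
    obtain x s where v: "v = (x, s)" by fastforce
    assume "\<not> (0, -1) \<bullet> v \<le> 0"
    then have s: "s < 0" by (simp add: v)
    obtain i where "i \<in> T" and i: "r i < b i \<bullet> (x /\<^sub>R (- s))" using assms(2) by blast
    have "b i \<bullet> x + r i * s \<le> 0" using le[OF \<open>i \<in> T\<close>] by (simp add: v)
    then show False using i s by (simp add: field_simps)
  qed
  from farkas[OF assms(1) this] obtain l
    where "\<forall>i\<in>T. 0 \<le> l i" "(0, -1) = (\<Sum>i\<in>T. l i *\<^sub>R (b i, r i))" .
  then show ?thesis by (intro that) auto
qed

text \<open>The certificate \<open>\<mu>\<close> is supported on a circuit: its support carries no other linear
  dependence. This is what makes its coefficients stable under perturbations of constant rank.\<close>

lemma interval_farkas: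
  fixes b :: "'i \<Rightarrow> 'a::euclidean_space"
  assumes "finite I" "J \<subseteq> I" and lu: "\<And>i. i \<in> J \<Longrightarrow> lo i \<le> up i"
    and infeasible: "\<nexists>v. (\<forall>i\<in>I. b i \<bullet> v \<le> up i) \<and> (\<forall>i\<in>J. lo i \<le> b i \<bullet> v)"
  obtains \<mu> C where "C \<subseteq> I" "C \<noteq> {}" "\<forall>i\<in>C. \<mu> i \<noteq> 0" "\<forall>i\<in>C. \<mu> i < 0 \<longrightarrow> i \<in> J"
    "(\<Sum>i\<in>C. \<mu> i *\<^sub>R b i) = 0" "(\<Sum>i\<in>C. \<mu> i * (if 0 < \<mu> i then up i else lo i)) < 0"
    "\<forall>c. (\<Sum>i\<in>C. c i *\<^sub>R b i) = 0 \<longrightarrow> (\<exists>a. \<forall>i\<in>C. c i = a * \<mu> i)"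
proof -
  \<comment> \<open>Every bound becomes an upper bound: \<open>(i, True)\<close> encodes the bound
    by \<open>up i\<close>, \<open>(i, False)\<close> the negated lower bound.\<close>
  define S where "S = I \<times> {True} \<union> J \<times> {False}"
  define sg :: "bool \<Rightarrow> real" where "sg = (\<lambda>t. if t then 1 else -1)"
  define r where "r = (\<lambda>(i, t). if t then up i else - lo i)"
  define B where "B = (\<lambda>(i, t). sg t *\<^sub>R b i)"
  have fS: "finite S" using assms(1,2) finite_subset by (auto simp: S_def)
  have "\<exists>p\<in>S. r p < B p \<bullet> v" for v
  proof -
    from infeasible consider i where "i \<in> I" "up i < b i \<bullet> v" | i where "i \<in> J" "b i \<bullet> v < lo i"
      by (meson not_le)
    then show ?thesis
    proof cases
      case 1
      then show ?thesis by (intro bexI[of _ "(i, True)"]) (auto simp: S_def r_def B_def sg_def)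
    next
      case 2
      then show ?thesis by (intro bexI[of _ "(i, False)"]) (auto simp: S_def r_def B_def sg_def)
    qed
  qed
  from infeasible_certificate[OF fS this] obtain l0
    where l0': "\<forall>p\<in>S. 0 \<le> l0 p" and l0sum: "(\<Sum>p\<in>S. l0 p *\<^sub>R (B p, r p)) = (0, -1)" .
  have l0: "0 \<le> l0 p" if "p \<in> S" for p using l0' that by blast
  \<comment> \<open>Independence is imposed on the rows including the right-hand sides; dropping
    that one coordinate leaves the \<open>B p\<close> with a single dependence up to a
    factor.\<close>
  obtain T l where T: "T \<subseteq> S" and l': "\<forall>p\<in>T. 0 < l p"
    and sums: "(\<Sum>p\<in>T. l p *\<^sub>R (B p, r p)) = (\<Sum>p\<in>S. l0 p *\<^sub>R (B p, r p))"
    and indep: "\<forall>c. (\<Sum>p\<in>T. c p *\<^sub>R (B p, r p)) = 0 \<longrightarrow> (\<forall>p\<in>T. c p = 0)"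
    by (rule conic_caratheodory[OF fS l0, where w = "\<lambda>p. (B p, r p)"])
  have lsum: "(\<Sum>p\<in>T. l p *\<^sub>R (B p, r p)) = (0, -1)" using sums l0sum by simp
  have l: "0 < l p" if "p \<in> T" for p using l' that by blast
  have fT: "finite T" using T fS finite_subset by blast
  \<comment> \<open>Adding \<open>\<rho>\<close> times the certificate cancels the last component,
    so independence makes \<open>c\<close> a multiple of \<open>l\<close>.\<close>
  have circuit: "c p = - (\<Sum>p\<in>T. c p * r p) * l p" if "(\<Sum>p\<in>T. c p *\<^sub>R B p) = 0" "p \<in> T" for c p
  proof -
    define \<rho> where "\<rho> = (\<Sum>p\<in>T. c p * r p)"
    have "(\<Sum>p\<in>T. c p *\<^sub>R (B p, r p)) = (0, \<rho>)"
      using that(1) by (simp add: prod_eq_iff fst_sum snd_sum \<rho>_def)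
    then have "(\<Sum>p\<in>T. (c p + \<rho> * l p) *\<^sub>R (B p, r p)) = (0, \<rho>) + \<rho> *\<^sub>R (\<Sum>p\<in>T. l p *\<^sub>R (B p, r p))"
      by (simp add: scaleR_add_left sum.distrib scaleR_sum_right del: scaleR_Pair)
    also have "\<dots> = 0" unfolding lsum by (simp add: zero_prod_def)
    finally have "c p + \<rho> * l p = 0" using that(2) indep[rule_format, of "\<lambda>p. c p + \<rho> * l p"] by blast
    then show ?thesis by (simp add: \<rho>_def)
  qed
  \<comment> \<open>If both bounds of \<open>i\<close> occurred, coefficients 1 and 1 would form a
    dependence of value \<open>up i - lo i\<close>, which is nonnegative, and \<open>circuit\<close>
    would make 1 nonpositive. Hence each index carries one sign.\<close>
  have inj: "inj_on fst T"
  proof (rule inj_onI)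
    fix p q assume pq: "p \<in> T" "q \<in> T" "fst p = fst q"
    show "p = q"
    proof (rule ccontr)
      assume "p \<noteq> q"
      then obtain i where i: "(i, True) \<in> T" "(i, False) \<in> T"
        using pq by (cases p; cases q; cases "snd p"; cases "snd q") auto
      define c where "c = (\<lambda>p. if p = (i, True) \<or> p = (i, False) then 1 else 0 :: real)"
      have two: "(\<Sum>p\<in>T. c p *\<^sub>R h p) = h (i, True) + h (i, False)" for h :: "_ \<Rightarrow> 'b::real_vector"
      proof -
        have "(\<Sum>p\<in>T. c p *\<^sub>R h p) = (\<Sum>p\<in>{(i, True), (i, False)}. c p *\<^sub>R h p)"
          by (rule sum.mono_neutral_right) (use fT i in \<open>auto simp: c_def\<close>)
        then show ?thesis by (simp add: c_def)
      qed
      have "(\<Sum>p\<in>T. c p *\<^sub>R B p) = 0" by (simp add: two B_def sg_def)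
      moreover have "(\<Sum>p\<in>T. c p * r p) = up i - lo i" using two[of r] by (simp add: r_def)
      moreover have "c (i, True) = 1" by (simp add: c_def)
      ultimately have "1 = - (up i - lo i) * l (i, True)" using circuit[of c, OF _ i(1)] by simp
      moreover have "i \<in> J" using i(2) T by (auto simp: S_def)
      ultimately show False using lu[of i] l[OF i(1)]
        by (smt (verit) mult_nonneg_nonneg mult_minus_left)
    qed
  qed
  define C where "C = fst ` T"
  define tt where "tt = (\<lambda>i. THE t. (i, t) \<in> T)"
  have tt: "tt i = t" if "(i, t) \<in> T" for i t
    unfolding tt_def
  proof (rule the_equality)
    show "(i, t) \<in> T" by fact
    show "t' = t" if "(i, t') \<in> T" for t'
      using inj_onD[OF inj _ that \<open>(i, t) \<in> T\<close>] by simp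
  qed
  \<comment> \<open>The sign of \<open>\<mu> i\<close> records which bound of \<open>i\<close>
    enters the certificate.\<close>
  define \<mu> where "\<mu> = (\<lambda>i. sg (tt i) * l (i, tt i))"
  have sgsq: "sg t * sg t = 1" for t by (simp add: sg_def)
  have sumC: "(\<Sum>i\<in>C. h i) = (\<Sum>p\<in>T. h (fst p))" for h :: "_ \<Rightarrow> 'b::comm_monoid_add"
    unfolding C_def by (simp add: sum.reindex[OF inj])
  have \<mu>: "\<mu> i = sg t * l (i, t)" if "(i, t) \<in> T" for i t using tt[OF that] by (simp add: \<mu>_def)
  have pos: "0 < \<mu> i \<longleftrightarrow> t" if "(i, t) \<in> T" for i t
    using \<mu>[OF that] l[OF that] by (cases t) (simp_all add: sg_def)
  show ?thesis
  proof
    show "C \<subseteq> I" using T assms(2) by (auto simp: C_def S_def dest!: subsetD)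
    show "C \<noteq> {}" using lsum by (auto simp: C_def zero_prod_def)
    show "\<forall>i\<in>C. \<mu> i \<noteq> 0"
    proof
      fix i assume i: "i \<in> C"
      obtain t where t: "(i, t) \<in> T" using i by (auto simp: C_def)
      then show "\<mu> i \<noteq> 0" using \<mu>[OF t] l[OF t] by (simp add: sg_def)
    qed
    show "\<forall>i\<in>C. \<mu> i < 0 \<longrightarrow> i \<in> J"
    proof (intro ballI impI)
      fix i assume i: "i \<in> C" "\<mu> i < 0"
      obtain t where "(i, t) \<in> T" using i(1) by (auto simp: C_def)
      then show "i \<in> J" using i(2) pos[of i t] T by (auto simp: S_def)
    qed
    have "(\<Sum>i\<in>C. \<mu> i *\<^sub>R b i) = (\<Sum>p\<in>T. l p *\<^sub>R B p)"
      unfolding sumC by (rule sum.cong) (auto simp: \<mu> B_def)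
    also have "\<dots> = 0" using arg_cong[OF lsum, of fst] by (simp add: fst_sum)
    finally show "(\<Sum>i\<in>C. \<mu> i *\<^sub>R b i) = 0" .
    have "(\<Sum>i\<in>C. \<mu> i * (if 0 < \<mu> i then up i else lo i)) = (\<Sum>p\<in>T. l p * r p)"
      unfolding sumC
    proof (rule sum.cong)
      fix p assume p: "p \<in> T"
      obtain i t where "p = (i, t)" by fastforce
      then show "\<mu> (fst p) * (if 0 < \<mu> (fst p) then up (fst p) else lo (fst p)) = l p * r p"
        using \<mu>[of i t] pos[of i t] p by (cases t) (simp_all add: r_def sg_def)
    qed simp
    also have "\<dots> = -1" using arg_cong[OF lsum, of snd] by (simp add: snd_sum)
    finally show "(\<Sum>i\<in>C. \<mu> i * (if 0 < \<mu> i then up i else lo i)) < 0" by simp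
    have "\<exists>a. \<forall>i\<in>C. c i = a * \<mu> i" if c: "(\<Sum>i\<in>C. c i *\<^sub>R b i) = 0" for c
    proof -
      define c' where "c' = (\<lambda>p. c (fst p) * sg (snd p))"
      have "(\<Sum>p\<in>T. c' p *\<^sub>R B p) = (\<Sum>i\<in>C. c i *\<^sub>R b i)"
        unfolding sumC by (rule sum.cong) (auto simp: c'_def B_def sgsq mult.assoc)
      then have *: "c' p = - (\<Sum>p\<in>T. c' p * r p) * l p" if p: "p \<in> T" for p
        using circuit[of c' p] p c by simp
      show ?thesis
      proof (intro exI ballI)
        fix i assume "i \<in> C"
        then obtain t where t: "(i, t) \<in> T" by (auto simp: C_def)
        have "c i * sg t = - (\<Sum>p\<in>T. c' p * r p) * l (i, t)"
          using *[OF t] by (simp add: c'_def)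
        from arg_cong[OF this, of "\<lambda>x. x * sg t"]
        have "c i * (sg t * sg t) = - (\<Sum>p\<in>T. c' p * r p) * (sg t * l (i, t))"
          by (simp add: mult.assoc mult.commute mult.left_commute)
        then show "c i = - (\<Sum>p\<in>T. c' p * r p) * \<mu> i" using \<mu>[OF t] by (simp add: sgsq)
      qed
    qed
    then show "\<forall>c. (\<Sum>i\<in>C. c i *\<^sub>R b i) = 0 \<longrightarrow> (\<exists>a. \<forall>i\<in>C. c i = a * \<mu> i)" by blast
  qed
qed

text \<open>Both attainments come from Farkas' lemma. If the infimum \<open>p\<close> were not
  attained, adding the row \<open>c \<bullet> v \<le> p\<close> would give an infeasible system,
  whose certificate is incompatible with values close to \<open>p\<close>. A homogenised system then
  yields the dual solution.\<close>

lemma lp_duality: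
  fixes b :: "'i \<Rightarrow> 'a::euclidean_space"
  assumes "finite I" and feasible: "\<forall>i\<in>I. b i \<bullet> v0 \<le> r i"
    and below: "\<And>v. \<forall>i\<in>I. b i \<bullet> v \<le> r i \<Longrightarrow> p0 \<le> c \<bullet> v"
  obtains v l where "\<forall>i\<in>I. b i \<bullet> v \<le> r i" "\<forall>i. 0 \<le> l i" "\<forall>i. i \<notin> I \<longrightarrow> l i = 0"
    "c + (\<Sum>i\<in>I. l i *\<^sub>R b i) = 0" "c \<bullet> v = - (\<Sum>i\<in>I. l i * r i)"
proof -
  define L where "L = {v. \<forall>i\<in>I. b i \<bullet> v \<le> r i}"
  define p where "p = (INF v\<in>L. c \<bullet> v)"
  have v0: "v0 \<in> L" using feasible by (simp add: L_def)
  have bdd: "bdd_below ((\<lambda>v. c \<bullet> v) ` L)" using below by (auto simp: L_def intro!: bdd_belowI[of _ p0])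
  have ple: "p \<le> c \<bullet> v" if "v \<in> L" for v
    unfolding p_def using bdd that by (rule cINF_lower)
  have "\<exists>v\<in>L. c \<bullet> v \<le> p"
  proof (rule ccontr)
    assume no: "\<not> (\<exists>v\<in>L. c \<bullet> v \<le> p)"
    define b' where "b' = case_option c b"
    define r' where "r' = case_option p r"
    have fin: "finite (insert None (Some ` I))" using assms(1) by simp
    have "\<exists>j\<in>insert None (Some ` I). r' j < b' j \<bullet> v" for v
      using no by (auto simp: L_def b'_def r'_def not_le)
    from infeasible_certificate[OF fin this] obtain l
      where l: "\<forall>j\<in>insert None (Some ` I). 0 \<le> l j"
        and lsum: "(\<Sum>j\<in>insert None (Some ` I). l j *\<^sub>R (b' j, r' j)) = (0, -1)" .
    have l0: "0 \<le> l None" using l by simp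
    have eq: "l None *\<^sub>R c + (\<Sum>i\<in>I. l (Some i) *\<^sub>R b i) = 0"
      "l None * p + (\<Sum>i\<in>I. l (Some i) * r i) = -1"
      using arg_cong[OF lsum, of fst] arg_cong[OF lsum, of snd] assms(1)
      by (simp_all add: fst_sum snd_sum b'_def r'_def sum.reindex)
    have gap: "1 \<le> l None * (c \<bullet> v - p)" if "v \<in> L" for v
    proof -
      have "0 = (l None *\<^sub>R c + (\<Sum>i\<in>I. l (Some i) *\<^sub>R b i)) \<bullet> v" by (simp add: eq(1))
      also have "\<dots> = l None * (c \<bullet> v) + (\<Sum>i\<in>I. l (Some i) * (b i \<bullet> v))"
        by (simp add: inner_add_left inner_sum_left)
      also have "\<dots> \<le> l None * (c \<bullet> v) + (\<Sum>i\<in>I. l (Some i) * r i)"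
        using that l by (intro add_left_mono sum_mono mult_left_mono) (auto simp: L_def)
      finally show ?thesis using eq(2) by (simp add: algebra_simps)
    qed
    \<comment> \<open>The added 1 keeps \<open>e\<close> positive even if \<open>l None\<close> is
      zero, and makes \<open>l None * e\<close> smaller than 1.\<close>
    define e where "e = 1 / (l None + 1)"
    have "0 < e" using l0 by (simp add: e_def)
    then have "(INF v\<in>L. c \<bullet> v) < p + e" by (simp add: p_def)
    then obtain v where v: "v \<in> L" "c \<bullet> v < p + e"
      using cINF_less_iff[of L "\<lambda>v. c \<bullet> v" "p + e"] v0 bdd by auto
    have "l None * (c \<bullet> v - p) \<le> l None * e" using v l0 by (intro mult_left_mono) auto
    also have "\<dots> < 1" using l0 by (simp add: e_def)
    finally show False using gap[OF v(1)] by simp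
  qed
  then obtain v where v: "v \<in> L" "c \<bullet> v = p" using ple by (meson order_antisym)
  \<comment> \<open>The extra row encodes \<open>s \<le> 0\<close>. For \<open>s < 0\<close> the
    pair rescales to a feasible point; for \<open>s = 0\<close> its first part is a recession
    direction, which is added to the minimiser.\<close>
  define b2 where "b2 = case_option (0, 1) (\<lambda>i. (b i, r i))"
  have fin: "finite (insert None (Some ` I))" using assms(1) by simp
  have "(- c, - p) \<bullet> x \<le> 0"
    if x: "\<And>j. j \<in> insert None (Some ` I) \<Longrightarrow> b2 j \<bullet> x \<le> 0" for x :: "'a \<times> real"
  proof -
    obtain z s where xs: "x = (z, s)" by fastforce
    have s: "s \<le> 0" using x[of None] by (simp add: b2_def xs)
    have bz: "b i \<bullet> z + r i * s \<le> 0" if "i \<in> I" for i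
      using x[of "Some i"] that by (simp add: b2_def xs)
    have "0 \<le> c \<bullet> z + p * s"
    proof (cases "s = 0")
      case False
      then have neg: "s < 0" using s by simp
      have "b i \<bullet> (z /\<^sub>R (- s)) \<le> r i" if "i \<in> I" for i
        using bz[OF that] neg by (simp add: field_simps)
      then have "z /\<^sub>R (- s) \<in> L" by (simp add: L_def)
      from ple[OF this] neg show ?thesis by (simp add: field_simps)
    next
      case True
      have "v + z \<in> L" using v(1) bz True by (force simp: L_def inner_add_right)
      from ple[OF this] v(2) True show ?thesis by (simp add: inner_add_right)
    qed
    then show ?thesis by (simp add: xs)
  qed
  from farkas[OF fin this] obtain l where l: "\<forall>j\<in>insert None (Some ` I). 0 \<le> l j"
    and lsum: "(- c, - p) = (\<Sum>j\<in>insert None (Some ` I). l j *\<^sub>R b2 j)" .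
  have eq: "- c = (\<Sum>i\<in>I. l (Some i) *\<^sub>R b i)" "- p = l None + (\<Sum>i\<in>I. l (Some i) * r i)"
    using arg_cong[OF lsum, of fst] arg_cong[OF lsum, of snd] assms(1)
    by (simp_all add: fst_sum snd_sum b2_def sum.reindex)
  \<comment> \<open>Weak duality bounds \<open>- p\<close> from above by the dual sum, the second
    part of \<open>eq\<close> from below; the weight \<open>l None\<close> is thereby forced to
    vanish.\<close>
  have "- p = - (c \<bullet> v)" using v by simp
  also have "\<dots> = (\<Sum>i\<in>I. l (Some i) * (b i \<bullet> v))"
    using arg_cong[OF eq(1), of "\<lambda>a. a \<bullet> v"] by (simp add: inner_sum_left)
  also have "\<dots> \<le> (\<Sum>i\<in>I. l (Some i) * r i)"
    using v l by (intro sum_mono mult_left_mono) (auto simp: L_def)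
  finally have "p = - (\<Sum>i\<in>I. l (Some i) * r i)" using eq(2) l by simp
  then have opt: "c \<bullet> v = - (\<Sum>i\<in>I. l (Some i) * r i)" using v(2) by simp
  define l' where "l' = (\<lambda>i. if i \<in> I then l (Some i) else 0)"
  have "(\<Sum>i\<in>I. l' i *\<^sub>R b i) = - c" "(\<Sum>i\<in>I. l' i * r i) = (\<Sum>i\<in>I. l (Some i) * r i)"
    unfolding eq(1) by (auto intro!: sum.cong simp: l'_def)
  then show ?thesis using v(1) l opt
    by (intro that[of v l']) (simp_all add: L_def l'_def)
qed

subsection \<open>Derivatives\<close>

lemma gradient_inner:
  assumes "(h has_derivative h') (at z)"
  shows "gradient h z \<bullet> w = h' w"
proof -
  have lin: "linear h'" using assms by (rule has_derivative_linear)
  have "(\<lambda>v. v \<bullet> adjoint h' 1) = h'" using adjoint_works[OF lin] by (simp add: fun_eq_iff)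
  then have "gradient h z = adjoint h' 1"
    using assms by (intro gradient_eqI) (simp add: gderiv_def)
  then show ?thesis using adjoint_works[OF lin] by (simp add: inner_commute)
qed

lemma gradient_section_snd:
  assumes "(h has_derivative h') (at (x, y))"
  shows "gradient (\<lambda>y'. h (x, y')) y \<bullet> v = h' (0, v)"
proof -
  have "((\<lambda>y'. (x, y')) has_derivative (\<lambda>v. (0, v))) (at y)"
    by (intro derivative_eq_intros) auto
  from gradient_inner[OF has_derivative_compose[OF this assms]] show ?thesis .
qed

lemma gradient_section_fst:
  assumes "(h has_derivative h') (at (x, y))"
  shows "gradient (\<lambda>x'. h (x', y)) x \<bullet> u = h' (u, 0)"
proof -
  have "((\<lambda>x'. (x', y)) has_derivative (\<lambda>u. (u, 0))) (at x)"
    by (intro derivative_eq_intros) auto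
  from gradient_inner[OF has_derivative_compose[OF this assms]] show ?thesis .
qed

lemma has_derivative_vec_nth_comp:
  assumes "(g has_derivative g') F"
  shows "((\<lambda>z. g z $ i) has_derivative (\<lambda>w. g' w $ i)) F"
  using bounded_linear_vec_nth assms by (rule bounded_linear.has_derivative)

text \<open>Continuous differentiability yields strict differentiability, so that both end points of
  the difference may move.\<close>

lemma cont_diff_quotient_tendsto:
  fixes f :: "'a::real_normed_vector \<Rightarrow> 'b::real_normed_vector"
  assumes der: "\<And>z. (f has_derivative blinfun_apply (f' z)) (at z)"
    and cont: "continuous_on UNIV f'"
    and p: "(p \<longlongrightarrow> z) F" and q: "(q \<longlongrightarrow> z) F"
    and w: "((\<lambda>k. (p k - q k) /\<^sub>R t k) \<longlongrightarrow> w) F"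
  shows "((\<lambda>k. (f (p k) - f (q k)) /\<^sub>R t k) \<longlongrightarrow> f' z w) F"
proof -
  define R where "R = (\<lambda>k. f (p k) - f (q k) - f' z (p k - q k))"
  have "((\<lambda>k. R k /\<^sub>R t k) \<longlongrightarrow> 0) F"
  proof (rule tendstoI)
    fix e :: real assume "0 < e"
    \<comment> \<open>Half of the tolerance divided by an eventual bound of the scaled increments;
      the 1 also excludes a zero denominator.\<close>
    define B where "B = e / (2 * (norm w + 1))"
    have nw: "0 < norm w + 1" using norm_ge_zero[of w] by linarith
    then have B: "0 < B" using \<open>0 < e\<close> by (simp add: B_def)
    have "isCont f' z" using cont by (simp add: continuous_on_eq_continuous_at)
    then obtain d where d: "0 < d" "\<And>x. dist x z < d \<Longrightarrow> dist (f' x) (f' z) < B"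
      using B unfolding continuous_at_eps_delta by blast
    have "\<forall>\<^sub>F k in F. dist (p k) z < d" "\<forall>\<^sub>F k in F. dist (q k) z < d"
      using p q d(1) by (auto dest: tendstoD)
    moreover have "\<forall>\<^sub>F k in F. norm ((p k - q k) /\<^sub>R t k) < norm w + 1"
      using tendsto_norm[OF w] by (rule order_tendstoD) simp
    ultimately show "\<forall>\<^sub>F k in F. dist (R k /\<^sub>R t k) 0 < e"
    proof eventually_elim
      case (elim k)
      \<comment> \<open>Mean value bound for the remainder of the linearisation at \<open>z\<close>,
        on a ball that contains the whole segment between the two moving points.\<close>
      have "norm (f (p k) - f (q k) - f' z (p k - q k)) \<le> norm (p k - q k) * B"
      proof (rule differentiable_bound_linearization[where S = "ball z d" and f' = "\<lambda>x. blinfun_apply (f' x)"])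
        show "q k + s *\<^sub>R (p k - q k) \<in> ball z d" if "s \<in> {0..1}" for s :: real
        proof -
          have "(1 - s) *\<^sub>R q k + s *\<^sub>R p k \<in> ball z d"
            using elim that by (intro convexD[OF convex_ball]) (auto simp: dist_commute)
          then show ?thesis by (simp add: algebra_simps)
        qed
        show "onorm (blinfun_apply (f' x) - blinfun_apply (f' z)) \<le> B" if "x \<in> ball z d" for x
        proof -
          have "norm (f' x - f' z) \<le> B" using d(2)[of x] that by (simp add: dist_commute dist_norm)
          then show ?thesis by (simp add: norm_blinfun.rep_eq minus_blinfun.rep_eq fun_diff_def)
        qed
      qed (use d(1) der in \<open>auto intro: has_derivative_at_withinI\<close>)
      then have "norm (R k /\<^sub>R t k) \<le> norm ((p k - q k) /\<^sub>R t k) * B"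
        by (simp add: R_def mult_left_mono mult.assoc)
      also have "\<dots> \<le> (norm w + 1) * B" using elim B by (intro mult_right_mono) auto
      also have "\<dots> < e" using \<open>0 < e\<close> nw by (simp add: B_def field_simps add_pos_nonneg)
      finally show ?case by simp
    qed
  qed
  moreover have "((\<lambda>k. f' z ((p k - q k) /\<^sub>R t k)) \<longlongrightarrow> f' z w) F"
    using w by (intro tendsto_intros)
  ultimately have "((\<lambda>k. R k /\<^sub>R t k + f' z ((p k - q k) /\<^sub>R t k)) \<longlongrightarrow> 0 + f' z w) F"
    by (rule tendsto_add)
  then show ?thesis by (simp add: R_def blinfun.scaleR_right blinfun.diff_right scaleR_diff_right)
qed

text \<open>A left inverse of the limit operator is enough:
  \<open>x k - M (w k) = M ((A0 - A k) (x k))\<close>, and \<open>A0 - A k\<close> is eventually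
  small enough to absorb \<open>x k\<close> into the left-hand side. No inverse of
  \<open>A k\<close> has to be controlled.\<close>

lemma blinfun_solution_tendsto:
  fixes A :: "'k \<Rightarrow> 'a::real_normed_vector \<Rightarrow>\<^sub>L 'a"
    and M :: "'a \<Rightarrow>\<^sub>L 'a"
  assumes A: "(A \<longlongrightarrow> A0) F" and w: "(w \<longlongrightarrow> w0) F"
    and inv: "\<And>x. M (A0 x) = x" and sol: "\<forall>\<^sub>F k in F. A k (x k) = w k"
  shows "(x \<longlongrightarrow> blinfun_apply M w0) F"
proof -
  have small: "((\<lambda>k. norm M * norm (A0 - A k)) \<longlongrightarrow> norm M * norm (A0 - A0)) F"
    using A by (intro tendsto_intros)
  then have "\<forall>\<^sub>F k in F. norm M * norm (A0 - A k) < 1 / 2"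
    by (rule order_tendstoD) simp
  then have "\<forall>\<^sub>F k in F. norm (x k - M (w k)) \<le> (norm M * norm (A0 - A k)) * (2 * norm (M (w k)))"
    using sol
  proof eventually_elim
    case (elim k)
    have "x k - M (w k) = M ((A0 - A k) (x k))"
      using elim(2) by (simp add: blinfun.diff_left blinfun.diff_right inv)
    also have "norm \<dots> \<le> norm M * norm (A0 - A k) * norm (x k)"
    proof -
      have "norm (M ((A0 - A k) (x k))) \<le> norm M * norm ((A0 - A k) (x k))" by (rule norm_blinfun)
      also have "\<dots> \<le> norm M * (norm (A0 - A k) * norm (x k))"
        by (intro mult_left_mono norm_blinfun norm_ge_zero)
      finally show ?thesis by (simp only: mult.assoc)
    qed
    finally have le: "norm (x k - M (w k)) \<le> norm M * norm (A0 - A k) * norm (x k)" .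
    also have "\<dots> \<le> 1 / 2 * norm (x k)" using elim(1) by (intro mult_right_mono) auto
    finally have "norm (x k) \<le> 2 * norm (M (w k))"
      using norm_triangle_ineq2[of "x k" "M (w k)"] by linarith
    then have "norm M * norm (A0 - A k) * norm (x k) \<le> norm M * norm (A0 - A k) * (2 * norm (M (w k)))"
      by (intro mult_left_mono) auto
    with le show ?case by linarith
  qed
  moreover have "((\<lambda>k. (norm M * norm (A0 - A k)) * (2 * norm (M (w k)))) \<longlongrightarrow> 0) F"
  proof -
    have "((\<lambda>k. (norm M * norm (A0 - A k)) * (2 * norm (M (w k))))
        \<longlongrightarrow> (norm M * norm (A0 - A0)) * (2 * norm (M w0))) F"
      using A w by (intro tendsto_intros)
    then show ?thesis by simp
  qed
  ultimately have "((\<lambda>k. x k - M (w k)) \<longlongrightarrow> 0) F" by (rule Lim_null_comparison)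
  moreover have "((\<lambda>k. M (w k)) \<longlongrightarrow> M w0) F" using w by (intro tendsto_intros)
  ultimately have "((\<lambda>k. (x k - M (w k)) + M (w k)) \<longlongrightarrow> 0 + M w0) F" by (rule tendsto_add)
  then show ?thesis by simp
qed

text \<open>The vector for \<open>l\<close> is the component of \<open>w l\<close> orthogonal to the
  span of the others, divided by its squared norm; independence keeps that component
  nonzero.\<close>

lemma dual_vectors:
  fixes w :: "'i \<Rightarrow> 'a::euclidean_space"
  assumes "finite T" and indep: "\<forall>c. (\<Sum>i\<in>T. c i *\<^sub>R w i) = 0 \<longrightarrow> (\<forall>i\<in>T. c i = 0)"
  obtains e where "\<forall>l\<in>T. \<forall>i\<in>T. w i \<bullet> e l = (if i = l then 1 else 0)"
proof -
  have "\<exists>e. \<forall>i\<in>T. w i \<bullet> e = (if i = l then 1 else 0)" if l: "l \<in> T" for l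
  proof -
    obtain y z where yz: "y \<in> span (w ` (T - {l}))"
      "\<And>x. x \<in> span (w ` (T - {l})) \<Longrightarrow> orthogonal z x" "w l = y + z"
      using orthogonal_subspace_decomp_exists[of "w ` (T - {l})" "w l"] by blast
    have "z \<noteq> 0"
    proof
      assume "z = 0"
      then have "w l \<in> span (w ` (T - {l}))" using yz by simp
      then obtain c where c: "w l = (\<Sum>i\<in>T - {l}. c i *\<^sub>R w i)"
        using span_family[of "T - {l}"] assms(1) by blast
      have "(\<Sum>i\<in>T. (c(l := -1)) i *\<^sub>R w i) = - w l + (\<Sum>i\<in>T - {l}. (c(l := -1)) i *\<^sub>R w i)"
        using l assms(1) by (simp add: sum.remove)
      also have "(\<Sum>i\<in>T - {l}. (c(l := -1)) i *\<^sub>R w i) = w l"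
        unfolding c by (rule sum.cong) auto
      finally show False using indep[rule_format, of "c(l := -1)" l] l by simp
    qed
    have "w i \<bullet> (z /\<^sub>R (z \<bullet> z)) = (if i = l then 1 else 0)" if "i \<in> T" for i
    proof (cases "i = l")
      case True
      then show ?thesis using yz(2)[OF yz(1)] yz(3) \<open>z \<noteq> 0\<close>
        by (simp add: inner_add_left inner_add_right orthogonal_def inner_commute)
    next
      case False
      then have "orthogonal z (w i)" using that by (intro yz(2) span_base) auto
      then show ?thesis using False by (simp add: orthogonal_def inner_commute)
    qed
    then show ?thesis by blast
  qed
  then show ?thesis using that by metis
qed

subsection \<open>Constant rank\<close>

text \<open>The functions \<open>g\<^sub>i\<close> with \<open>i\<close> in a circuit satisfy near \<open>z0\<close> a relation whose coefficients
  are close to the linear dependence \<open>\<mu>\<close> of their partial gradients: \<open>\<Psi>\<close> straightens all but one of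
  them, and constant rank makes the remaining one a function of these and of the parameter.\<close>

lemma constant_rank_relation:
  fixes g :: "'a::euclidean_space \<times> 'b::euclidean_space \<Rightarrow> real^'p"
    and b :: "'a \<times> 'b \<Rightarrow> 'p \<Rightarrow> 'b"
  assumes der: "\<And>z. (g has_derivative blinfun_apply (g' z)) (at z)"
    and cont: "continuous_on UNIV g'"
    and b: "\<And>z y i. b z i \<bullet> y = g' z (0, y) $ i"
    and C: "C \<noteq> {}" "\<And>i. i \<in> C \<Longrightarrow> g z0 $ i = 0" "\<And>i. i \<in> C \<Longrightarrow> \<mu> i \<noteq> 0"
    and dep: "(\<Sum>i\<in>C. \<mu> i *\<^sub>R b z0 i) = 0"
    and circuit: "\<And>c. (\<Sum>i\<in>C. c i *\<^sub>R b z0 i) = 0 \<Longrightarrow> \<exists>a. \<forall>i\<in>C. c i = a * \<mu> i"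
    and "0 < \<delta>" and rank: "\<And>K z. K \<subseteq> C \<Longrightarrow> dist z z0 < \<delta> \<Longrightarrow> dim (b z ` K) = dim (b z0 ` K)"
    and z: "z \<longlonglongrightarrow> z0" and uk: "uk \<longlonglongrightarrow> u" and fst_z: "\<And>k. fst (z k) = fst z0 + t k *\<^sub>R uk k"
  obtains m s where "\<And>i. i \<in> C \<Longrightarrow> (\<lambda>k. m k i) \<longlonglongrightarrow> \<mu> i"
    "s \<longlonglongrightarrow> (\<Sum>i\<in>C. \<mu> i * g' z0 (u, 0) $ i)"
    "\<forall>\<^sub>F k in sequentially. (\<Sum>i\<in>C. m k i * g (z k) $ i) = t k * s k"
proof -
  \<comment> \<open>Any index may be singled out: a dependence that vanishes at \<open>j\<close> is
    the zero multiple of \<open>\<mu>\<close>, so the gradients over \<open>C'\<close> are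
    independent.\<close>
  obtain j where j: "j \<in> C" using C(1) by blast
  define C' where "C' = C - {j}"
  have fC': "finite C'" by simp
  have sumC: "(\<Sum>i\<in>C. h i) = h j + (\<Sum>i\<in>C'. h i)" for h :: "'p \<Rightarrow> 'c::comm_monoid_add"
    unfolding C'_def using j by (simp add: sum.remove)
  have indep: "c i = 0" if c: "(\<Sum>i\<in>C'. c i *\<^sub>R b z0 i) = 0" "i \<in> C'" for c i
  proof -
    have "(\<Sum>i\<in>C'. (c(j := 0)) i *\<^sub>R b z0 i) = (\<Sum>i\<in>C'. c i *\<^sub>R b z0 i)"
      by (rule sum.cong) (auto simp: C'_def)
    then have "(\<Sum>i\<in>C. (c(j := 0)) i *\<^sub>R b z0 i) = 0" using c(1) unfolding sumC by simp
    from circuit[OF this] obtain a where a: "\<forall>i\<in>C. (c(j := 0)) i = a * \<mu> i" by blast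
    from bspec[OF a j] C(3)[OF j] have "a = 0" by simp
    then show ?thesis using bspec[OF a, of i] c(2) by (auto simp: C'_def split: if_splits)
  qed
  then have "\<forall>c. (\<Sum>i\<in>C'. c i *\<^sub>R b z0 i) = 0 \<longrightarrow> (\<forall>i\<in>C'. c i = 0)" by blast
  from dual_vectors[OF fC' this] obtain e
    where "\<forall>l\<in>C'. \<forall>i\<in>C'. b z0 i \<bullet> e l = (if i = l then 1 else 0)" .
  then have e: "\<And>i l. i \<in> C' \<Longrightarrow> l \<in> C' \<Longrightarrow> b z0 i \<bullet> e l = (if i = l then 1 else 0)" by blast
  \<comment> \<open>A right inverse of the gradients over \<open>C'\<close>, without parameter
    component; this makes \<open>N\<close> below square to zero.\<close>
  define K :: "real^'p \<Rightarrow> 'a \<times> 'b" where "K = (\<lambda>c. (0, \<Sum>i\<in>C'. (c $ i) *\<^sub>R e i))"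
  have "linear K"
    by (rule linearI) (simp_all add: K_def scaleR_add_left sum.distrib scaleR_sum_right)
  then have K: "blinfun_apply (Blinfun K) = K"
    by (simp add: bounded_linear_Blinfun_apply linear_conv_bounded_linear)
  define P :: "'a \<times> 'b \<Rightarrow> 'a \<times> 'b" where "P = (\<lambda>z. (0, snd z))"
  have "linear P" by (rule linearI) (simp_all add: P_def)
  then have P: "blinfun_apply (Blinfun P) = P"
    by (simp add: bounded_linear_Blinfun_apply linear_conv_bounded_linear)
  define D where "D = g' z0 o\<^sub>L Blinfun P"
  have D: "D w $ i = b z0 i \<bullet> snd w" for w i by (simp add: D_def P b) (simp add: P_def)
  have bK: "b z0 l \<bullet> snd (K c) = c $ l" if "l \<in> C'" for l c
  proof -
    have "b z0 l \<bullet> snd (K c) = (\<Sum>i\<in>C'. c $ i * (b z0 l \<bullet> e i))"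
      by (simp add: K_def inner_sum_right)
    also have "\<dots> = (\<Sum>i\<in>C'. if i = l then c $ i else 0)"
      by (rule sum.cong) (auto simp: e that)
    finally show ?thesis using that by simp
  qed
  \<comment> \<open>Paired with \<open>b z0 l\<close> for \<open>l \<in> C'\<close>, the second
    component of \<open>\<Psi> p\<close> gives \<open>g p $ l\<close>: these functions become linear
    coordinates, and the parameter is left alone.\<close>
  define \<Psi> where "\<Psi> = (\<lambda>z. z + K (g z - D z))"
  define \<Psi>' where "\<Psi>' = (\<lambda>z. id_blinfun + (Blinfun K o\<^sub>L (g' z - D)))"
  have \<Psi>'_apply: "\<Psi>' p x = x + K (g' p x - D x)" for p x
    by (simp add: \<Psi>'_def blinfun.add_left blinfun.diff_left K)
  have der\<Psi>: "(\<Psi> has_derivative blinfun_apply (\<Psi>' p)) (at p)" for p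
  proof -
    have "((\<lambda>z. z + Blinfun K (g z - D z)) has_derivative (\<lambda>x. x + Blinfun K (g' p x - D x))) (at p)"
      by (intro derivative_intros der bounded_linear.has_derivative[OF blinfun.bounded_linear_right])
    then show ?thesis unfolding \<Psi>_def K by (rule has_derivative_eq_rhs) (simp add: \<Psi>'_apply fun_eq_iff)
  qed
  have cont\<Psi>': "continuous_on UNIV \<Psi>'"
    unfolding \<Psi>'_def by (intro continuous_intros cont)
  define N where "N = Blinfun K o\<^sub>L (g' z0 - D)"
  have N: "N x = K (g' z0 (fst x, 0))" for x
  proof -
    have "g' z0 x - D x = g' z0 (x - P x)" by (simp add: D_def P blinfun.diff_right)
    also have "x - P x = (fst x, 0)" by (simp add: P_def prod_eq_iff)
    finally show ?thesis by (simp add: N_def blinfun.diff_left K)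
  qed
  \<comment> \<open>The derivative of \<open>\<Psi>\<close> at \<open>z0\<close> is the identity
    plus \<open>N\<close>, and \<open>N\<close> squares to zero, so \<open>M\<close> inverts
    it.\<close>
  define M where "M = id_blinfun - N"
  have K0: "K 0 = 0" by (simp add: K_def zero_prod_def)
  have fstK: "fst (K c) = 0" for c by (simp add: K_def)
  have M: "M x = x - K (g' z0 (fst x, 0))" for x by (simp add: M_def blinfun.diff_left N)
  have MA: "M (\<Psi>' z0 x) = x" for x
  proof -
    have "\<Psi>' z0 x = x + N x" by (simp add: \<Psi>'_def N_def blinfun.add_left)
    then show ?thesis by (simp add: M N fstK)
  qed
  then have "M o\<^sub>L \<Psi>' z0 = id_blinfun" by (intro blinfun_eqI) simp
  then obtain U V \<Theta> \<Theta>' where U: "open U" "z0 \<in> U" "open V" "\<Psi> z0 \<in> V" and hom: "homeomorphism U V \<Psi> \<Theta>"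
    and der\<Theta>: "\<And>q. q \<in> V \<Longrightarrow> (\<Theta> has_derivative \<Theta>' q) (at q)"
    and \<Theta>': "\<And>q. q \<in> V \<Longrightarrow> \<Theta>' q = inv (blinfun_apply (\<Psi>' (\<Theta> q)))"
    and bij: "\<And>q. q \<in> V \<Longrightarrow> bij (blinfun_apply (\<Psi>' (\<Theta> q)))"
    by (rule inverse_function_theorem[OF open_UNIV der\<Psi> cont\<Psi>' UNIV_I]) (rule that; simp)
  have sol: "\<Psi>' (\<Theta> q) (\<Theta>' q w) = w" if "q \<in> V" for q w
    using \<Theta>'[OF that] bij[OF that] by (simp add: bij_is_surj surj_f_inv_f)
  define q0 where "q0 = \<Psi> z0"
  have \<Theta>\<Psi>: "\<Theta> (\<Psi> p) = p" if "p \<in> U" for p using hom that by (auto simp: homeomorphism_def)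
  have "isCont \<Theta> q0" using has_derivative_continuous[OF der\<Theta>[OF U(4)]] by (simp add: q0_def)
  moreover have \<Theta>0: "\<Theta> q0 = z0" using \<Theta>\<Psi>[OF U(2)] by (simp add: q0_def)
  ultimately obtain d where d: "0 < d" "\<forall>q. dist q q0 < d \<longrightarrow> dist (\<Theta> q) z0 < \<delta>"
    using \<open>0 < \<delta>\<close> unfolding continuous_at_eps_delta by fastforce
  obtain d' where d': "0 < d'" "ball q0 d' \<subseteq> V" using U(3,4) open_contains_ball unfolding q0_def by blast
  \<comment> \<open>A ball, because the mean value argument runs along segments, on which both the
    local inverse and the rank condition are available.\<close>
  define \<rho> where "\<rho> = min d d'"
  have \<rho>: "0 < \<rho>" "\<And>q. q \<in> ball q0 \<rho> \<Longrightarrow> q \<in> V" "\<And>q. q \<in> ball q0 \<rho> \<Longrightarrow> dist (\<Theta> q) z0 < \<delta>"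
    using d d' by (auto simp: \<rho>_def dist_commute)
  define \<Phi> where "\<Phi> = (\<lambda>q. g (\<Theta> q) $ j)"
  define \<Phi>' where "\<Phi>' = (\<lambda>q w. g' (\<Theta> q) (\<Theta>' q w) $ j)"
  have der\<Phi>: "(\<Phi> has_derivative \<Phi>' q) (at q)" if "q \<in> V" for q
    unfolding \<Phi>_def \<Phi>'_def
    by (rule has_derivative_vec_nth_comp[OF has_derivative_compose[OF der\<Theta>[OF that] der]])
  have lin\<Phi>': "linear (\<Phi>' q)" if "q \<in> V" for q
    using der\<Phi>[OF that] by (rule has_derivative_linear)
  have straight: "b z0 l \<bullet> snd (\<Psi> p) = g p $ l" if "l \<in> C'" for l p
    using bK[OF that, of "g p - D p"] D[of p l] by (simp add: \<Psi>_def inner_add_right)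
  have j_span: "b z0 j \<in> span (b z0 ` C')"
  proof -
    have "b z0 j = - ((\<Sum>i\<in>C'. \<mu> i *\<^sub>R b z0 i) /\<^sub>R \<mu> j)"
    proof -
      have "\<mu> j *\<^sub>R b z0 j = - (\<Sum>i\<in>C'. \<mu> i *\<^sub>R b z0 i)"
        using dep unfolding sumC by (simp add: eq_neg_iff_add_eq_0)
      then show ?thesis using C(3)[OF j] by (metis scaleR_minus_right vector_fraction_eq_iff divideR_right)
    qed
    also have "\<dots> \<in> span (b z0 ` C')"
      by (intro span_neg span_scale span_sum span_base) auto
    finally show ?thesis .
  qed
  \<comment> \<open>Constant rank enters here: it keeps \<open>b ?p j\<close> in the span of the
    other gradients, so in the new coordinates the last function varies with the second component
    only through the straightened coordinates.\<close>
  have rel: "\<Phi>' q (0, \<zeta>) = (\<Sum>l\<in>C'. \<Phi>' q (0, e l) * (b z0 l \<bullet> \<zeta>))" if q: "q \<in> ball q0 \<rho>" for q \<zeta>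
  proof -
    let ?p = "\<Theta> q"
    have CC': "b y ` C = insert (b y j) (b y ` C')" for y using j by (auto simp: C'_def)
    have "dim (b ?p ` C') = dim (b z0 ` C')" "dim (b ?p ` C) = dim (b z0 ` C)"
      using rank \<rho>(3)[OF q] by (auto simp: C'_def)
    moreover have "dim (b z0 ` C) = dim (b z0 ` C')"
      unfolding CC' using j_span by (simp add: dim_insert)
    ultimately have "span (b ?p ` C') = span (b ?p ` C)"
      by (intro dim_eq_span) (auto simp: C'_def)
    then have "b ?p j \<in> span (b ?p ` C')" using j by (simp add: span_base)
    then obtain \<nu> where \<nu>: "b ?p j = (\<Sum>l\<in>C'. \<nu> l *\<^sub>R b ?p l)" using span_family[OF fC'] by blast
    have key: "\<Phi>' q (0, \<zeta>) = (\<Sum>l\<in>C'. \<nu> l * (b z0 l \<bullet> \<zeta>))" for \<zeta>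
    proof -
      let ?x = "\<Theta>' q (0, \<zeta>)"
      have x: "?x + K (g' ?p ?x - D ?x) = (0, \<zeta>)" using sol[OF \<rho>(2)[OF q]] by (simp add: \<Psi>'_apply)
      from arg_cong[OF x, of fst] have "fst ?x = 0" by (simp add: fstK)
      then have x0: "?x = (0, snd ?x)" by (simp add: prod_eq_iff)
      have "b ?p l \<bullet> snd ?x = b z0 l \<bullet> \<zeta>" if "l \<in> C'" for l
      proof -
        have "b z0 l \<bullet> \<zeta> = b z0 l \<bullet> snd ?x + (g' ?p ?x - D ?x) $ l"
          using arg_cong[OF x, of "\<lambda>w. b z0 l \<bullet> snd w"] bK[OF that, of "g' ?p ?x - D ?x"]
          by (simp add: inner_add_right)
        also have "\<dots> = g' ?p ?x $ l" by (simp add: D)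
        also have "\<dots> = b ?p l \<bullet> snd ?x" by (subst x0) (simp add: b)
        finally show ?thesis by simp
      qed
      moreover have "\<Phi>' q (0, \<zeta>) = b ?p j \<bullet> snd ?x" unfolding \<Phi>'_def by (subst x0) (simp add: b)
      ultimately show ?thesis by (simp add: \<nu> inner_sum_left)
    qed
    have "\<Phi>' q (0, e l) = \<nu> l" if "l \<in> C'" for l
    proof -
      have "\<Phi>' q (0, e l) = (\<Sum>i\<in>C'. if i = l then \<nu> i else 0)"
        unfolding key by (rule sum.cong) (auto simp: e that)
      then show ?thesis using that by simp
    qed
    then show ?thesis unfolding key[of \<zeta>] by simp
  qed
  define q where "q = (\<lambda>k. \<Psi> (z k))"
  have "isCont \<Psi> z0" using der\<Psi> by (rule has_derivative_continuous)
  then have q: "q \<longlonglongrightarrow> q0" unfolding q_def q0_def using z by (rule isCont_tendsto_compose)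
  have evq: "\<forall>\<^sub>F k in sequentially. q k \<in> ball q0 \<rho>"
    using tendstoD[OF q \<rho>(1)] by (simp add: dist_commute)
  have evU: "\<forall>\<^sub>F k in sequentially. z k \<in> U" using z U(1,2) by (rule topological_tendstoD)
  have mid: "q0 + s *\<^sub>R (q k - q0) \<in> ball q0 \<rho>" if "q k \<in> ball q0 \<rho>" "s \<in> {0..1}" for s k
  proof -
    have "(1 - s) *\<^sub>R q0 + s *\<^sub>R q k \<in> ball q0 \<rho>"
      using \<rho>(1) that by (intro convexD[OF convex_ball]) auto
    then show ?thesis by (simp add: algebra_simps)
  qed
  \<comment> \<open>Mean value theorem from \<open>q0\<close> to \<open>q k\<close>; the value 0 for
    the finitely many \<open>k\<close> outside the ball is a placeholder.\<close>
  have "\<exists>s. s \<in> {0..1} \<and> (q k \<in> ball q0 \<rho> \<longrightarrow> \<Phi> (q k) - \<Phi> q0 = \<Phi>' (q0 + s *\<^sub>R (q k - q0)) (q k - q0))" for k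
  proof (cases "q k \<in> ball q0 \<rho>")
    case True
    let ?c = "\<lambda>s. q0 + s *\<^sub>R (q k - q0)"
    have "((\<lambda>s. \<Phi> (?c s)) has_derivative (\<lambda>h. \<Phi>' (?c s) (h *\<^sub>R (q k - q0)))) (at s within {0..1})"
      if "0 \<le> s" "s \<le> 1" for s :: real
    proof -
      have "?c s \<in> V" using mid[OF True] that \<rho>(2) by simp
      then show ?thesis
        by (intro has_derivative_compose[where f = ?c and g = \<Phi>] der\<Phi>) (auto intro!: derivative_eq_intros)
    qed
    from mvt_simple[of 0 1 "\<lambda>s. \<Phi> (?c s)", OF zero_less_one this]
    obtain s where "s \<in> {0<..<1}" "\<Phi> (?c 1) - \<Phi> (?c 0) = \<Phi>' (?c s) ((1 - 0) *\<^sub>R (q k - q0))"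
      by blast
    then show ?thesis by (intro exI[of _ s]) auto
  qed (auto intro: exI[of _ 0])
  then obtain \<sigma> where \<sigma>: "\<And>k. \<sigma> k \<in> {0..1}"
    "\<And>k. q k \<in> ball q0 \<rho> \<Longrightarrow> \<Phi> (q k) - \<Phi> q0 = \<Phi>' (q0 + \<sigma> k *\<^sub>R (q k - q0)) (q k - q0)"
    by metis
  define r where "r = (\<lambda>k. q0 + \<sigma> k *\<^sub>R (q k - q0))"
  have r: "r \<longlonglongrightarrow> q0"
  proof -
    have "norm (\<sigma> k *\<^sub>R (q k - q0)) \<le> norm (q k - q0)" for k
      using \<sigma>(1)[of k] by (simp add: mult_left_le_one_le)
    then have "\<forall>\<^sub>F k in sequentially. norm (\<sigma> k *\<^sub>R (q k - q0)) \<le> norm (q k - q0)" by simp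
    moreover have "(\<lambda>k. norm (q k - q0)) \<longlonglongrightarrow> 0"
      using q by (intro tendsto_norm_zero) (simp add: LIM_zero)
    ultimately have "(\<lambda>k. \<sigma> k *\<^sub>R (q k - q0)) \<longlonglongrightarrow> 0" by (rule Lim_null_comparison)
    then have "(\<lambda>k. q0 + \<sigma> k *\<^sub>R (q k - q0)) \<longlonglongrightarrow> q0 + 0" by (intro tendsto_intros)
    then show ?thesis by (simp add: r_def)
  qed
  have evr: "\<forall>\<^sub>F k in sequentially. r k \<in> V" using r U(3,4) unfolding q0_def by (rule topological_tendstoD)
  have \<Theta>r: "(\<lambda>k. \<Theta> (r k)) \<longlonglongrightarrow> z0"
    using isCont_tendsto_compose[OF \<open>isCont \<Theta> q0\<close> r] by (simp add: \<Theta>0)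
  have cont_at: "isCont h z0" if "continuous_on UNIV h" for h :: "'a \<times> 'b \<Rightarrow> 'c::topological_space"
    using that continuous_on_eq_continuous_at[OF open_UNIV, of h] by blast
  \<comment> \<open>Instead of continuity of \<open>\<Theta>'\<close>, its values are treated as
    solutions of linear equations with convergent operators.\<close>
  have lim\<Phi>': "(\<lambda>k. \<Phi>' (r k) (w k)) \<longlonglongrightarrow> g' z0 (M w0) $ j" if w: "w \<longlonglongrightarrow> w0" for w w0
  proof -
    have A: "(\<lambda>k. \<Psi>' (\<Theta> (r k))) \<longlonglongrightarrow> \<Psi>' z0"
      using \<Theta>r by (rule isCont_tendsto_compose[OF cont_at[OF cont\<Psi>']])
    have "\<forall>\<^sub>F k in sequentially. \<Psi>' (\<Theta> (r k)) (\<Theta>' (r k) (w k)) = w k"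
      using evr by eventually_elim (rule sol)
    then have "(\<lambda>k. \<Theta>' (r k) (w k)) \<longlonglongrightarrow> M w0"
      by (rule blinfun_solution_tendsto[OF A w MA])
    moreover have "(\<lambda>k. g' (\<Theta> (r k))) \<longlonglongrightarrow> g' z0"
      using \<Theta>r by (rule isCont_tendsto_compose[OF cont_at[OF cont]])
    ultimately show ?thesis unfolding \<Phi>'_def by (intro tendsto_intros)
  qed
  \<comment> \<open>Pairing the dependence with the dual vector \<open>e l\<close> leaves only the
    terms of \<open>j\<close> and \<open>l\<close>.\<close>
  have be: "\<mu> j * (b z0 j \<bullet> e l) = - \<mu> l" if "l \<in> C'" for l
  proof -
    have "0 = (\<Sum>i\<in>C. \<mu> i *\<^sub>R b z0 i) \<bullet> e l" by (simp add: dep)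
    also have "\<dots> = \<mu> j * (b z0 j \<bullet> e l) + (\<Sum>i\<in>C'. \<mu> i * (b z0 i \<bullet> e l))"
      unfolding sumC by (simp add: inner_add_left inner_sum_left)
    also have "(\<Sum>i\<in>C'. \<mu> i * (b z0 i \<bullet> e l)) = (\<Sum>i\<in>C'. if i = l then \<mu> i else 0)"
      by (rule sum.cong) (auto simp: e that)
    also have "\<dots> = \<mu> l" using that by simp
    finally show ?thesis by simp
  qed
  \<comment> \<open>The mean value identity read as a relation and scaled by \<open>\<mu> j\<close>,
    so that the limits are the given coefficients themselves and not a multiple of them.\<close>
  define m where "m = (\<lambda>k i. if i = j then \<mu> j else - \<mu> j * \<Phi>' (r k) (0, e i))"
  define s where "s = (\<lambda>k. \<mu> j * \<Phi>' (r k) (uk k, 0))"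
  show ?thesis
  proof
    fix i assume i: "i \<in> C"
    show "(\<lambda>k. m k i) \<longlonglongrightarrow> \<mu> i"
    proof (cases "i = j")
      case False
      then have "i \<in> C'" using i by (simp add: C'_def)
      have "(\<lambda>k. \<Phi>' (r k) (0, e i)) \<longlonglongrightarrow> g' z0 (M (0, e i)) $ j" by (intro lim\<Phi>' tendsto_const)
      also have "g' z0 (M (0, e i)) $ j = b z0 j \<bullet> e i" by (simp add: M b zero_prod_def[symmetric] K0)
      finally have "(\<lambda>k. - \<mu> j * \<Phi>' (r k) (0, e i)) \<longlonglongrightarrow> - \<mu> j * (b z0 j \<bullet> e i)"
        by (intro tendsto_intros)
      then show ?thesis using be[OF \<open>i \<in> C'\<close>] False by (simp add: m_def)
    qed (simp add: m_def)
  next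
    have "(\<lambda>k. (uk k, 0)) \<longlonglongrightarrow> (u, 0 :: 'b)" using uk by (intro tendsto_intros)
    then have "s \<longlonglongrightarrow> \<mu> j * g' z0 (M (u, 0)) $ j" unfolding s_def by (intro tendsto_mult tendsto_const lim\<Phi>')
    also have "\<mu> j * g' z0 (M (u, 0)) $ j = (\<Sum>i\<in>C. \<mu> i * g' z0 (u, 0) $ i)"
    proof -
      have "g' z0 (M (u, 0)) $ j = g' z0 (u, 0) $ j - b z0 j \<bullet> snd (K (g' z0 (u, 0)))"
        by (simp add: M b blinfun.diff_right) (simp add: K_def)
      then have "\<mu> j * g' z0 (M (u, 0)) $ j
          = \<mu> j * g' z0 (u, 0) $ j - (\<Sum>i\<in>C'. g' z0 (u, 0) $ i * (\<mu> j * (b z0 j \<bullet> e i)))"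
        by (simp add: K_def inner_sum_right right_diff_distrib sum_distrib_left mult.left_commute)
      also have "(\<Sum>i\<in>C'. g' z0 (u, 0) $ i * (\<mu> j * (b z0 j \<bullet> e i))) = - (\<Sum>i\<in>C'. \<mu> i * g' z0 (u, 0) $ i)"
        unfolding sum_negf[symmetric] by (rule sum.cong) (auto simp: be)
      finally show ?thesis by (simp add: sumC)
    qed
    finally show "s \<longlonglongrightarrow> (\<Sum>i\<in>C. \<mu> i * g' z0 (u, 0) $ i)" .
  next
    show "\<forall>\<^sub>F k in sequentially. (\<Sum>i\<in>C. m k i * g (z k) $ i) = t k * s k"
      using evq evU
    proof eventually_elim
      case (elim k)
      have rk: "r k \<in> ball q0 \<rho>" unfolding r_def using mid[OF elim(1) \<sigma>(1)] .
      have gz: "\<Phi> (q k) = g (z k) $ j" "\<Phi> q0 = 0"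
        using \<Theta>\<Psi> elim(2) U(2) C(2)[OF j] by (simp_all add: \<Phi>_def q_def q0_def)
      have "fst (q k - q0) = t k *\<^sub>R uk k"
        by (simp add: q_def q0_def \<Psi>_def fstK fst_z)
      then have split: "q k - q0 = t k *\<^sub>R (uk k, 0) + (0, snd (q k - q0))"
        by (simp add: prod_eq_iff)
      have lin: "linear (\<Phi>' (r k))" using lin\<Phi>' \<rho>(2)[OF rk] .
      have "g (z k) $ j = \<Phi>' (r k) (q k - q0)" using \<sigma>(2)[OF elim(1)] gz by (simp add: r_def)
      also have "\<dots> = \<Phi>' (r k) (t k *\<^sub>R (uk k, 0) + (0, snd (q k - q0)))"
        by (rule arg_cong[OF split])
      also have "\<dots> = t k * \<Phi>' (r k) (uk k, 0) + \<Phi>' (r k) (0, snd (q k - q0))"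
        by (simp only: linear_add[OF lin] linear_cmul[OF lin] real_scaleR_def)
      also have "\<Phi>' (r k) (0, snd (q k - q0)) = (\<Sum>l\<in>C'. \<Phi>' (r k) (0, e l) * (b z0 l \<bullet> snd (q k - q0)))"
        by (rule rel[OF rk])
      also have "\<dots> = (\<Sum>l\<in>C'. \<Phi>' (r k) (0, e l) * g (z k) $ l)"
      proof (rule sum.cong[OF refl])
        fix l assume l: "l \<in> C'"
        then have "b z0 l \<bullet> snd (q k - q0) = g (z k) $ l"
          using straight[OF l] C(2)[of l] by (simp add: q_def q0_def inner_diff_right C'_def)
        then show "\<Phi>' (r k) (0, e l) * (b z0 l \<bullet> snd (q k - q0)) = \<Phi>' (r k) (0, e l) * g (z k) $ l" by simp
      qed
      finally have eq: "g (z k) $ j = t k * \<Phi>' (r k) (uk k, 0) + (\<Sum>l\<in>C'. \<Phi>' (r k) (0, e l) * g (z k) $ l)" .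
      have "(\<Sum>i\<in>C. m k i * g (z k) $ i)
          = \<mu> j * g (z k) $ j + (\<Sum>i\<in>C'. - \<mu> j * (\<Phi>' (r k) (0, e i) * g (z k) $ i))"
        unfolding sumC by (simp add: m_def) (rule sum.cong, auto simp: C'_def)
      also have "\<dots> = \<mu> j * (g (z k) $ j - (\<Sum>i\<in>C'. \<Phi>' (r k) (0, e i) * g (z k) $ i))"
        by (simp add: right_diff_distrib sum_negf sum_distrib_left)
      also have "\<dots> = t k * s k" unfolding eq by (simp add: s_def)
      finally show ?case .
    qed
  qed
qed

subsection \<open>Feasible points near a solution\<close>

text \<open>Applied to extended reals, whose compactness gives limits to unbounded quotients as
  well; finitely many successive extractions suffice.\<close>

lemma finite_family_convergent_subseq:
  fixes X :: "nat \<Rightarrow> 'i \<Rightarrow> 'a::{complete_linorder,linorder_topology}"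
  assumes "finite I"
  obtains r l where "strict_mono r" "\<forall>i\<in>I. (\<lambda>k. X (r k) i) \<longlonglongrightarrow> l i"
proof -
  from assms have "\<exists>r l. strict_mono r \<and> (\<forall>i\<in>I. (\<lambda>k. X (r k) i) \<longlonglongrightarrow> l i)"
  proof (induction I)
    case empty
    show ?case using strict_mono_id by auto
  next
    case (insert j I)
    then obtain r l where r: "strict_mono r" "\<And>i. i \<in> I \<Longrightarrow> (\<lambda>k. X (r k) i) \<longlonglongrightarrow> l i" by blast
    obtain s a where s: "strict_mono s" "((\<lambda>k. X (r k) j) \<circ> s) \<longlonglongrightarrow> a"
      using compact_complete_linorder by blast
    have "(\<lambda>k. X ((r \<circ> s) k) i) \<longlonglongrightarrow> (l(j := a)) i" if "i \<in> insert j I" for i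
    proof (cases "i = j")
      case True
      then show ?thesis using s(2) by (simp add: o_def)
    next
      case False
      then show ?thesis using LIMSEQ_subseq_LIMSEQ[OF r(2) s(1), of i] that by (simp add: o_def)
    qed
    moreover have "strict_mono (r \<circ> s)" using r(1) s(1) by (rule strict_mono_o)
    ultimately show ?case by blast
  qed
  then show ?thesis using that by blast
qed

section \<open>Correction of nearly feasible points by Robinson stability\<close>

lemma closed_feas_map:
  assumes "continuous_on UNIV g"
  shows "closed (feas_map g x)"
proof -
  have "continuous_on UNIV (\<lambda>y. g (x, y) $ i)" for i
    by (intro continuous_intros continuous_on_compose2[OF assms, of UNIV "\<lambda>y. (x, y)"]) auto
  then show ?thesis
    unfolding feas_map_def by (intro closed_Collect_all closed_Collect_le continuous_on_const)
qed

lemma eventually_dir_nbhd: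
  assumes "(s \<longlongrightarrow> 0) F" "\<forall>\<^sub>F k in F. 0 \<le> s k" "0 < \<epsilon>" "0 < \<delta>"
  shows "\<forall>\<^sub>F k in F. s k *\<^sub>R u \<in> dir_nbhd \<epsilon> \<delta> u"
proof -
  have "((\<lambda>k. s k *\<^sub>R u) \<longlongrightarrow> 0 *\<^sub>R u) F" using assms(1) by (intro tendsto_intros)
  then have "\<forall>\<^sub>F k in F. dist (s k *\<^sub>R u) 0 < \<epsilon>" using assms(3) by (intro tendstoD) auto
  with assms(2) show ?thesis
    by eventually_elim (use assms(4) in \<open>simp add: dir_nbhd_def mult.commute\<close>)
qed

text \<open>The feasible sets are closed, so the distance is attained and the stability estimate
  concerns actual feasible points. A general filter covers both one-sided limits and
  sequences.\<close>

lemma robinson_stable_projection: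
  assumes rs: "robinson_stable_dir g xb yb u" and g: "continuous_on UNIV g"
    and s: "(s \<longlongrightarrow> 0) F" "\<forall>\<^sub>F k in F. 0 \<le> s k" and y: "(y \<longlongrightarrow> yb) F"
  obtains \<kappa> w where "\<forall>\<^sub>F k in F. w k \<in> feas_map g (xb + s k *\<^sub>R u)"
    "\<forall>\<^sub>F k in F. norm (w k - y k) \<le> \<kappa> * norm (\<chi> i. max 0 (g (xb + s k *\<^sub>R u, y k) $ i))"
proof -
  obtain \<kappa> \<epsilon> \<delta> where pos: "0 < \<epsilon>" "0 < \<delta>" and st: "\<And>z y. z \<in> dir_nbhd \<epsilon> \<delta> u \<Longrightarrow> y \<in> ball yb \<epsilon> \<Longrightarrow>
      feas_map g (xb + z) \<noteq> {} \<and> infdist y (feas_map g (xb + z)) \<le> \<kappa> * norm (\<chi> i. max 0 (g (xb + z, y) $ i))"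
    using rs unfolding robinson_stable_dir_def by blast
  define w where "w = (\<lambda>k. SOME w. w \<in> feas_map g (xb + s k *\<^sub>R u) \<and>
    infdist (y k) (feas_map g (xb + s k *\<^sub>R u)) = dist (y k) w)"
  have "\<forall>\<^sub>F k in F. y k \<in> ball yb \<epsilon>" using tendstoD[OF y pos(1)] by (simp add: dist_commute)
  with eventually_dir_nbhd[OF s pos, of u]
  have "\<forall>\<^sub>F k in F. w k \<in> feas_map g (xb + s k *\<^sub>R u) \<and>
      norm (w k - y k) \<le> \<kappa> * norm (\<chi> i. max 0 (g (xb + s k *\<^sub>R u, y k) $ i))"
  proof eventually_elim
    case (elim k)
    let ?S = "feas_map g (xb + s k *\<^sub>R u)"
    have ne: "?S \<noteq> {}"
      and le: "infdist (y k) ?S \<le> \<kappa> * norm (\<chi> i. max 0 (g (xb + s k *\<^sub>R u, y k) $ i))"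
      using st[OF elim] by blast+
    obtain x where "x \<in> ?S" "infdist (y k) ?S = dist (y k) x"
      using infdist_attains_inf[OF closed_feas_map[OF g] ne] by blast
    then have "\<exists>x. x \<in> ?S \<and> infdist (y k) ?S = dist (y k) x" by blast
    from someI_ex[OF this] have "w k \<in> ?S \<and> infdist (y k) ?S = dist (y k) (w k)"
      unfolding w_def .
    with le show ?case by (simp add: dist_norm norm_minus_commute)
  qed
  then show ?thesis by (intro that[of w \<kappa>]) (auto elim: eventually_mono)
qed

text \<open>The projection estimate divided by \<open>t\<close>. The parameter step \<open>s\<close>
  is independent of the error scale \<open>t\<close>: the upper bound takes them equal, the lower
  bound takes \<open>s = 0\<close>.\<close>

lemma robinson_stable_correction:
  assumes rs: "robinson_stable_dir g xb yb u" and g: "continuous_on UNIV g"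
    and s: "(s \<longlongrightarrow> 0) F" "\<forall>\<^sub>F k in F. 0 \<le> s k" and y: "(y \<longlongrightarrow> yb) F"
    and t: "\<forall>\<^sub>F k in F. (0::real) < t k"
    and viol: "\<And>i. ((\<lambda>k. max 0 (g (xb + s k *\<^sub>R u, y k) $ i) / t k) \<longlongrightarrow> 0) F"
  obtains w where "\<forall>\<^sub>F k in F. w k \<in> feas_map g (xb + s k *\<^sub>R u)"
    "((\<lambda>k. (w k - y k) /\<^sub>R t k) \<longlongrightarrow> 0) F"
proof -
  obtain \<kappa> w where w: "\<forall>\<^sub>F k in F. w k \<in> feas_map g (xb + s k *\<^sub>R u)"
    "\<forall>\<^sub>F k in F. norm (w k - y k) \<le> \<kappa> * norm (\<chi> i. max 0 (g (xb + s k *\<^sub>R u, y k) $ i))"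
    using robinson_stable_projection[OF rs g s y] by blast
  let ?v = "\<lambda>k. (\<chi> i. max 0 (g (xb + s k *\<^sub>R u, y k) $ i) / t k)"
  have "(?v \<longlongrightarrow> 0) F" using viol by (intro vec_tendstoI) simp
  then have "((\<lambda>k. \<kappa> * norm (?v k)) \<longlongrightarrow> \<kappa> * norm (0 :: real^'c)) F" by (intro tendsto_intros)
  then have lim: "((\<lambda>k. \<kappa> * norm (?v k)) \<longlongrightarrow> 0) F" by simp
  have "\<forall>\<^sub>F k in F. norm ((w k - y k) /\<^sub>R t k) \<le> \<kappa> * norm (?v k)"
    using w(2) t
  proof eventually_elim
    case (elim k)
    let ?m = "\<chi> i. max 0 (g (xb + s k *\<^sub>R u, y k) $ i)"
    have "?v k = ?m /\<^sub>R t k" by (simp add: vec_eq_iff divide_inverse mult.commute)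
    then have "\<kappa> * norm (?v k) = (\<kappa> * norm ?m) / t k" using elim(2) by (simp add: divide_inverse)
    moreover have "norm ((w k - y k) /\<^sub>R t k) = norm (w k - y k) / t k"
      using elim(2) by (simp add: divide_inverse)
    ultimately show ?case using elim by (simp add: divide_right_mono)
  qed
  from Lim_null_comparison[OF this lim] w(1) show ?thesis by (rule that[rotated])
qed

lemma violation_tendsto_0:
  fixes h t :: "'k \<Rightarrow> real"
  assumes "((\<lambda>k. h k / t k) \<longlongrightarrow> a) F" "a \<le> 0" "\<forall>\<^sub>F k in F. 0 < t k"
  shows "((\<lambda>k. max 0 (h k) / t k) \<longlongrightarrow> 0) F"
proof -
  have "((\<lambda>k. max 0 (h k / t k)) \<longlongrightarrow> max 0 a) F" using assms(1) by (intro tendsto_intros)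
  then have "((\<lambda>k. max 0 (h k / t k)) \<longlongrightarrow> 0) F" using assms(2) by simp
  then show ?thesis
    by (rule Lim_transform_eventually)
      (use assms(3) in eventually_elim, auto simp: max_def divide_le_0_iff zero_le_divide_iff)
qed

lemma violation_tendsto_0':
  fixes h t :: "'k \<Rightarrow> real"
  assumes "\<forall>\<^sub>F k in F. h k < 0"
  shows "((\<lambda>k. max 0 (h k) / t k) \<longlongrightarrow> 0) F"
  by (rule tendsto_eventually) (use assms in eventually_elim, auto)

text \<open>The increments \<open>y (r k) - w k\<close> have order \<open>t (r k)\<close>, although \<open>y k - yb\<close> need not.\<close>

lemma feasible_increment_limit:
  fixes g :: "(real^'n) \<times> (real^'m) \<Rightarrow> real^'p"
  assumes der: "\<And>z. (g has_derivative blinfun_apply (g' z)) (at z)"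
    and cont: "continuous_on UNIV g'"
    and yb: "yb \<in> feas_map g xb" and rcr: "rcr_regular g xb yb" and rs: "robinson_stable_dir g xb yb u"
    and t: "\<And>k. 0 < t k" "t \<longlonglongrightarrow> 0" and uk: "uk \<longlonglongrightarrow> u" and y: "y \<longlonglongrightarrow> yb"
    and feas: "\<And>k. y k \<in> feas_map g (xb + t k *\<^sub>R uk k)"
  obtains r v w where "strict_mono r" "v \<in> lin_cone g xb yb u"
    "\<forall>\<^sub>F k in sequentially. w k \<in> feas_map g xb"
    "(\<lambda>k. (y (r k) - w k) /\<^sub>R t (r k)) \<longlonglongrightarrow> v"
proof -
  define I where "I = active_set g xb yb"
  define b where "b = (\<lambda>z i. gradient (\<lambda>y'. g (fst z, y') $ i) (snd z))"
  let ?z0 = "(xb, yb)"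
  define A where "A = (\<lambda>i. g' ?z0 (u, 0) $ i)"
  have gcont: "continuous_on UNIV g"
    using has_derivative_continuous[OF der] by (simp add: continuous_at_imp_continuous_on)
  have gi: "\<And>i. i \<in> I \<Longrightarrow> g ?z0 $ i = 0" "\<And>i. i \<notin> I \<Longrightarrow> g ?z0 $ i < 0"
    using yb by (auto simp: I_def active_set_def feas_map_def order.strict_iff_order)
  have b: "b z i \<bullet> v = g' z (0, v) $ i" for z v i
    unfolding b_def using der[of z]
    by (intro gradient_section_snd[where h = "\<lambda>z. g z $ i"] has_derivative_vec_nth_comp) simp
  have split: "g' ?z0 (u, v) $ i = A i + b ?z0 i \<bullet> v" for v i
  proof -
    have "g' ?z0 (u, v) = g' ?z0 (u, 0) + g' ?z0 (0, v)" by (simp flip: blinfun.add_right)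
    then show ?thesis by (simp add: A_def b)
  qed
  have lin_cone: "v \<in> lin_cone g xb yb u \<longleftrightarrow> (\<forall>i\<in>I. A i + b ?z0 i \<bullet> v \<le> 0)" for v
  proof -
    have "gradient (\<lambda>z. g z $ i) ?z0 \<bullet> (u, v) = g' ?z0 (u, v) $ i" for i
      by (intro gradient_inner has_derivative_vec_nth_comp der)
    then show ?thesis by (simp add: lin_cone_def I_def split)
  qed
  define c where "c = (\<lambda>k. g (xb + t k *\<^sub>R uk k, y k))"
  have c0: "c k $ i \<le> 0" for k i using feas[of k] by (simp add: c_def feas_map_def)
  obtain r l where r: "strict_mono r"
    and l: "\<forall>i\<in>I. (\<lambda>k. ereal (c (r k) $ i / t (r k))) \<longlonglongrightarrow> l i"
    using finite_family_convergent_subseq[of I "\<lambda>k i. ereal (c k $ i / t k)"] by auto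
  \<comment> \<open>A quotient tending to \<open>-\<infinity>\<close> leaves room for any increment,
    so only the indices in \<open>J\<close> impose a lower bound on \<open>v\<close>.\<close>
  define J where "J = {i\<in>I. l i \<noteq> -\<infinity>}"
  define a where "a = (\<lambda>i. real_of_ereal (l i))"
  have l0: "l i \<le> 0" if "i \<in> I" for i
  proof (rule LIMSEQ_le_const2)
    show "(\<lambda>k. ereal (c (r k) $ i / t (r k))) \<longlonglongrightarrow> l i" using l that by blast
    show "\<exists>N. \<forall>n\<ge>N. ereal (c (r n) $ i / t (r n)) \<le> 0"
      using c0 t(1) by (auto simp: divide_le_0_iff less_imp_le zero_ereal_def)
  qed
  have a: "(\<lambda>k. c (r k) $ i / t (r k)) \<longlonglongrightarrow> a i" "a i \<le> 0" if i: "i \<in> J" for i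
  proof -
    have "l i = ereal (a i)" using i l0[of i] by (cases "l i") (auto simp: J_def a_def)
    then show "(\<lambda>k. c (r k) $ i / t (r k)) \<longlonglongrightarrow> a i" "a i \<le> 0"
      using l l0[of i] i by (auto simp: J_def)
  qed
  let ?x = "\<lambda>k. xb + t (r k) *\<^sub>R uk (r k)" and ?y = "\<lambda>k. y (r k)" and ?t = "\<lambda>k. t (r k)" and ?u = "\<lambda>k. uk (r k)"
  have tr: "?t \<longlonglongrightarrow> 0" and ur: "?u \<longlonglongrightarrow> u" and yr: "?y \<longlonglongrightarrow> yb"
    using LIMSEQ_subseq_LIMSEQ[OF _ r] t(2) uk y by (auto simp: o_def)
  have "?x \<longlonglongrightarrow> xb + 0 *\<^sub>R u" by (intro tendsto_intros tr ur)
  then have zr: "(\<lambda>k. (?x k, ?y k)) \<longlonglongrightarrow> ?z0" using yr by (intro tendsto_intros) simp_all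
  \<comment> \<open>The upper bounds place \<open>v\<close> in the linearised cone; the lower bounds
    ensure that stepping back to \<open>xb\<close> along \<open>(u, v)\<close> causes no first-order
    violation.\<close>
  have "\<exists>v. (\<forall>i\<in>I. b ?z0 i \<bullet> v \<le> - A i) \<and> (\<forall>i\<in>J. a i - A i \<le> b ?z0 i \<bullet> v)"
  proof (rule ccontr)
    assume no: "\<not> ?thesis"
    have "finite I" "J \<subseteq> I" "\<And>i. i \<in> J \<Longrightarrow> a i - A i \<le> - A i" using a(2) by (auto simp: J_def)
    from interval_farkas[OF this no]
    obtain \<mu> C where C: "C \<subseteq> I" "C \<noteq> {}" and nz: "\<forall>i\<in>C. \<mu> i \<noteq> 0" and C4: "\<forall>i\<in>C. \<mu> i < 0 \<longrightarrow> i \<in> J"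
      and dep: "(\<Sum>i\<in>C. \<mu> i *\<^sub>R b ?z0 i) = 0"
      and neg: "(\<Sum>i\<in>C. \<mu> i * (if 0 < \<mu> i then - A i else a i - A i)) < 0"
      and "\<forall>c. (\<Sum>i\<in>C. c i *\<^sub>R b ?z0 i) = 0 \<longrightarrow> (\<exists>a. \<forall>i\<in>C. c i = a * \<mu> i)" .
    then have circ: "\<exists>a. \<forall>i\<in>C. c i = a * \<mu> i" if "(\<Sum>i\<in>C. c i *\<^sub>R b ?z0 i) = 0" for c
      using that by blast
    have C3: "\<mu> i \<noteq> 0" if "i \<in> C" for i using nz that by blast
    obtain \<delta> where \<delta>: "0 < \<delta>" and rk: "\<forall>K\<subseteq>I. \<exists>r. \<forall>(x, y)\<in>ball ?z0 \<delta>.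
        dim ((\<lambda>j. gradient (\<lambda>y'. g (x, y') $ j) y) ` K) = r"
      using rcr unfolding rcr_regular_def I_def by blast
    have rank: "dim (b z ` K) = dim (b ?z0 ` K)" if K: "K \<subseteq> C" and z: "dist z ?z0 < \<delta>" for K z
    proof -
      obtain r where r: "\<forall>(x, y)\<in>ball ?z0 \<delta>. dim ((\<lambda>j. gradient (\<lambda>y'. g (x, y') $ j) y) ` K) = r"
        using rk K C(1) by (meson order_trans)
      have "dim (b z ` K) = r" if "z \<in> ball ?z0 \<delta>" for z
        using bspec[OF r that] by (simp add: b_def case_prod_beta)
      from this[of z] this[of ?z0] z \<delta> show ?thesis by (simp add: dist_commute)
    qed
    obtain m s where m: "\<And>i. i \<in> C \<Longrightarrow> (\<lambda>k. m k i) \<longlonglongrightarrow> \<mu> i"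
      and s: "s \<longlonglongrightarrow> (\<Sum>i\<in>C. \<mu> i * g' ?z0 (u, 0) $ i)"
      and rel: "\<forall>\<^sub>F k in sequentially. (\<Sum>i\<in>C. m k i * g (?x k, ?y k) $ i) = ?t k * s k"
    proof (rule constant_rank_relation[OF der cont b C(2) _ C3 dep circ \<delta> rank zr ur])
      show "g ?z0 $ i = 0" if "i \<in> C" for i using gi C(1) that by blast
      show "fst (?x k, ?y k) = fst ?z0 + ?t k *\<^sub>R ?u k" for k by simp
    qed (assumption | rule that; assumption)+
    \<comment> \<open>Terms with \<open>\<mu> i > 0\<close> may tend to \<open>-\<infinity>\<close>
      but are eventually nonpositive, so 0 bounds them; the other indices lie in \<open>J\<close>,
      where the terms converge.\<close>
    define h where "h = (\<lambda>k i. if 0 < \<mu> i then 0 else m k i * (c (r k) $ i / ?t k))"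
    have "\<forall>\<^sub>F k in sequentially. \<forall>i\<in>C. 0 < \<mu> i \<longrightarrow> 0 < m k i"
    proof (rule eventually_ball_finite)
      show "\<forall>i\<in>C. \<forall>\<^sub>F k in sequentially. 0 < \<mu> i \<longrightarrow> 0 < m k i"
        using order_tendstoD(1)[OF m] by (auto intro: eventually_mono)
    qed simp
    with rel have "\<forall>\<^sub>F k in sequentially. s k \<le> (\<Sum>i\<in>C. h k i)"
    proof eventually_elim
      case (elim k)
      have "?t k * s k = (\<Sum>i\<in>C. m k i * c (r k) $ i)" using elim(1) by (simp add: c_def)
      then have "s k = (\<Sum>i\<in>C. m k i * (c (r k) $ i / ?t k))"
        using t(1)[of "r k"] by (simp add: field_simps flip: sum_divide_distrib)
      also have "\<dots> \<le> (\<Sum>i\<in>C. h k i)"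
      proof (rule sum_mono)
        fix i assume i: "i \<in> C"
        have "c (r k) $ i / ?t k \<le> 0" using c0 t(1)[of "r k"] by (simp add: divide_le_0_iff)
        then have "m k i * (c (r k) $ i / ?t k) \<le> 0" if "0 < \<mu> i"
          using elim(2) i that by (intro mult_nonneg_nonpos) (auto intro: less_imp_le)
        then show "m k i * (c (r k) $ i / ?t k) \<le> h k i" by (simp add: h_def)
      qed
      finally show ?case .
    qed
    moreover have "(\<lambda>k. \<Sum>i\<in>C. h k i) \<longlonglongrightarrow> (\<Sum>i\<in>C. if 0 < \<mu> i then 0 else \<mu> i * a i)"
    proof (rule tendsto_sum)
      fix i assume i: "i \<in> C"
      show "(\<lambda>k. h k i) \<longlonglongrightarrow> (if 0 < \<mu> i then 0 else \<mu> i * a i)"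
      proof (cases "0 < \<mu> i")
        case False
        then have "i \<in> J" using C3[OF i] C4 i by force
        from tendsto_mult[OF m[OF i] a(1)[OF this]] False show ?thesis by (simp add: h_def)
      qed (simp add: h_def)
    qed
    ultimately have "(\<Sum>i\<in>C. \<mu> i * A i) \<le> (\<Sum>i\<in>C. if 0 < \<mu> i then 0 else \<mu> i * a i)"
      using tendsto_le[OF sequentially_bot _ s] by (simp add: A_def)
    moreover have "(\<Sum>i\<in>C. \<mu> i * (if 0 < \<mu> i then - A i else a i - A i))
        = (\<Sum>i\<in>C. if 0 < \<mu> i then 0 else \<mu> i * a i) - (\<Sum>i\<in>C. \<mu> i * A i)"
      unfolding sum_subtractf[symmetric] by (rule sum.cong) (auto simp: algebra_simps)
    ultimately show False using neg by simp
  qed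
  then obtain v where v: "\<And>i. i \<in> I \<Longrightarrow> A i + b ?z0 i \<bullet> v \<le> 0" "\<And>i. i \<in> J \<Longrightarrow> a i \<le> A i + b ?z0 i \<bullet> v"
    by (smt (verit))
  define y' where "y' = (\<lambda>k. ?y k - ?t k *\<^sub>R v)"
  have "y' \<longlonglongrightarrow> yb - 0 *\<^sub>R v" unfolding y'_def by (intro tendsto_intros tr yr)
  then have y': "y' \<longlonglongrightarrow> yb" by simp
  then have zr': "(\<lambda>k. (xb, y' k)) \<longlonglongrightarrow> ?z0" by (intro tendsto_intros)
  \<comment> \<open>Both end points move, but their difference is exactly \<open>?t k\<close> times
    \<open>(?u k, v)\<close>, whatever the distance of \<open>?y k\<close> from
    \<open>yb\<close>.\<close>
  have "(\<lambda>k. ((?x k, ?y k) - (xb, y' k)) /\<^sub>R ?t k) \<longlonglongrightarrow> (u, v)"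
  proof -
    have "((?x k, ?y k) - (xb, y' k)) /\<^sub>R ?t k = (?u k, v)" for k
      using t(1)[of "r k"] by (simp add: y'_def)
    then show ?thesis using ur by (auto intro: tendsto_Pair)
  qed
  from cont_diff_quotient_tendsto[OF der cont zr zr' this]
  have quot: "(\<lambda>k. (c (r k) $ i - g (xb, y' k) $ i) / ?t k) \<longlonglongrightarrow> A i + b ?z0 i \<bullet> v" for i
    unfolding split[symmetric]
    by (drule_tac tendsto_vec_nth[of _ _ _ i]) (simp add: c_def divide_inverse mult.commute)
  have viol: "(\<lambda>k. max 0 (g (xb + 0 *\<^sub>R u, y' k) $ i) / ?t k) \<longlonglongrightarrow> 0" for i
  proof -
    have eq: "g (xb, y' k) $ i / ?t k = c (r k) $ i / ?t k - (c (r k) $ i - g (xb, y' k) $ i) / ?t k" for k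
      by (simp add: diff_divide_distrib)
    consider "i \<in> J" | "i \<in> I" "l i = -\<infinity>" | "i \<notin> I" by (auto simp: J_def)
    then show ?thesis
    proof cases
      case 1
      have "(\<lambda>k. g (xb, y' k) $ i / ?t k) \<longlonglongrightarrow> a i - (A i + b ?z0 i \<bullet> v)"
        unfolding eq by (intro tendsto_diff a(1)[OF 1] quot)
      then have "(\<lambda>k. max 0 (g (xb, y' k) $ i) / ?t k) \<longlonglongrightarrow> 0"
        by (rule violation_tendsto_0) (use v(2)[OF 1] t(1) in auto)
      then show ?thesis by simp
    next
      case 2
      \<comment> \<open>Any number below the limit of the increment quotients would serve to
        separate them from the quotients that tend to \<open>-\<infinity>\<close>.\<close>
      let ?M = "A i + b ?z0 i \<bullet> v - 1"
      have "(\<lambda>k. ereal (c (r k) $ i / ?t k)) \<longlonglongrightarrow> -\<infinity>" using 2 l by metis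
      then have "\<forall>\<^sub>F k in sequentially. c (r k) $ i / ?t k < ?M"
        unfolding tendsto_MInfty by auto
      moreover have "\<forall>\<^sub>F k in sequentially. ?M < (c (r k) $ i - g (xb, y' k) $ i) / ?t k"
        by (rule order_tendstoD[OF quot]) simp
      ultimately have "\<forall>\<^sub>F k in sequentially. g (xb, y' k) $ i < 0"
      proof eventually_elim
        case (elim k)
        then have "g (xb, y' k) $ i / ?t k < 0" unfolding eq by linarith
        then show ?case using t(1)[of "r k"] by (simp add: divide_less_0_iff)
      qed
      then show ?thesis using violation_tendsto_0' by simp
    next
      case 3
      have "(\<lambda>k. g (xb, y' k) $ i) \<longlonglongrightarrow> g ?z0 $ i"
        using gcont zr' by (auto simp: continuous_on_eq_continuous_at intro!: tendsto_vec_nth isCont_tendsto_compose[of _ g])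
      from order_tendstoD(2)[OF this gi(2)[OF 3]] show ?thesis using violation_tendsto_0' by simp
    qed
  qed
  obtain w where w: "\<forall>\<^sub>F k in sequentially. w k \<in> feas_map g (xb + 0 *\<^sub>R u)"
    "(\<lambda>k. (w k - y' k) /\<^sub>R ?t k) \<longlonglongrightarrow> 0"
    using robinson_stable_correction[OF rs gcont tendsto_const _ y' _ viol] t(1) by auto
  have "(\<lambda>k. v - (w k - y' k) /\<^sub>R ?t k) \<longlonglongrightarrow> v - 0" by (intro tendsto_intros w(2))
  moreover have "v - (w k - y' k) /\<^sub>R ?t k = (?y k - w k) /\<^sub>R ?t k" for k
  proof -
    have "y' k /\<^sub>R ?t k = ?y k /\<^sub>R ?t k - v"
      using t(1)[of "r k"] by (simp add: y'_def scaleR_diff_right)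
    then show ?thesis by (simp add: scaleR_diff_right)
  qed
  ultimately show ?thesis using that[OF r, of v w] w(1) v(1) lin_cone by simp
qed

subsection \<open>The value function\<close>

lemma value_fun_le: "y \<in> feas_map g x \<Longrightarrow> value_fun f g x \<le> ereal (f (x, y))"
  unfolding value_fun_def by (rule INF_lower)

lemma value_fun_eq:
  assumes "y \<in> sol_map f g x"
  shows "value_fun f g x = ereal (f (x, y))"
proof (rule antisym)
  show "value_fun f g x \<le> ereal (f (x, y))" using assms by (intro value_fun_le) (simp add: sol_map_def)
  show "ereal (f (x, y)) \<le> value_fun f g x"
    unfolding value_fun_def using assms by (intro INF_greatest) (simp add: sol_map_def)
qed

lemma at_right_0_facts:
  "((\<lambda>t. t) \<longlongrightarrow> (0::real)) (at_right 0)" "\<forall>\<^sub>F t in at_right (0::real). 0 < t"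
  "\<forall>\<^sub>F t in at_right (0::real). 0 \<le> t"
proof -
  show pos: "\<forall>\<^sub>F t in at_right (0::real). 0 < t" by (rule eventually_at_right_less)
  then show "\<forall>\<^sub>F t in at_right (0::real). 0 \<le> t" by eventually_elim simp
  show "((\<lambda>t. t) \<longlongrightarrow> (0::real)) (at_right 0)" by (rule tendsto_ident_at)
qed

text \<open>Projecting the fixed point \<open>y\<close> onto the perturbed feasible sets gives
  feasible points that converge to \<open>y\<close>. This brings the perturbed values below the
  threshold in restricted inf-compactness.\<close>

lemma value_fun_upper_semicont:
  fixes g :: "(real^'n) \<times> (real^'m) \<Rightarrow> real^'p"
  assumes f: "continuous_on UNIV f" and g: "continuous_on UNIV g"
    and y: "y \<in> feas_map g xb" and rs: "robinson_stable_dir g xb y u" and "0 < e"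
  shows "\<forall>\<^sub>F t in at_right 0. value_fun f g (xb + t *\<^sub>R u) < ereal (f (xb, y) + e)"
proof -
  let ?F = "at_right (0::real)"
  obtain \<kappa> w where w: "\<forall>\<^sub>F t in ?F. w t \<in> feas_map g (xb + t *\<^sub>R u)"
    and le: "\<forall>\<^sub>F t in ?F. norm (w t - y) \<le> \<kappa> * norm (\<chi> i. max 0 (g (xb + t *\<^sub>R u, y) $ i))"
    using robinson_stable_projection[OF rs g at_right_0_facts(1,3) tendsto_const] by blast
  have cont: "isCont h z" if "continuous_on UNIV h" for h :: "(real^'n) \<times> (real^'m) \<Rightarrow> 'b::topological_space" and z
    using that continuous_on_eq_continuous_at[OF open_UNIV, of h] by blast
  have "((\<lambda>t. xb + t *\<^sub>R u) \<longlongrightarrow> xb + 0 *\<^sub>R u) ?F" by (intro tendsto_intros at_right_0_facts)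
  then have x: "((\<lambda>t. xb + t *\<^sub>R u) \<longlongrightarrow> xb) ?F" by simp
  have "((\<lambda>t. g (xb + t *\<^sub>R u, y)) \<longlongrightarrow> g (xb, y)) ?F"
    by (rule isCont_tendsto_compose[OF cont[OF g]]) (intro tendsto_intros x)
  then have "((\<lambda>t. \<kappa> * norm (\<chi> i. max 0 (g (xb + t *\<^sub>R u, y) $ i)))
      \<longlongrightarrow> \<kappa> * norm (\<chi> i. max 0 (g (xb, y) $ i))) ?F"
    by (intro tendsto_intros)
  moreover have "(\<chi> i. max 0 (g (xb, y) $ i)) = 0" using y by (simp add: feas_map_def vec_eq_iff)
  ultimately have "((\<lambda>t. w t - y) \<longlongrightarrow> 0) ?F" using Lim_null_comparison[OF le] by simp
  then have "(w \<longlongrightarrow> y) ?F" by (rule LIM_zero_cancel)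
  then have "((\<lambda>t. f (xb + t *\<^sub>R u, w t)) \<longlongrightarrow> f (xb, y)) ?F"
    by (intro isCont_tendsto_compose[OF cont[OF f]] tendsto_Pair x)
  then have "\<forall>\<^sub>F t in ?F. f (xb + t *\<^sub>R u, w t) < f (xb, y) + e"
    using \<open>0 < e\<close> by (intro order_tendstoD(2)) auto
  with w show ?thesis
  proof eventually_elim
    case (elim t)
    then show ?case using value_fun_le[OF elim(1), of f] by (simp add: le_less_trans)
  qed
qed

text \<open>Along \<open>y + t v\<close> the active constraints are violated by \<open>o(t)\<close>
  at most, and the inactive ones not at all for small \<open>t\<close>. The corrected arc therefore
  keeps the tangent \<open>(u, v)\<close>.\<close>

lemma value_fun_upper_bound:
  fixes g :: "(real^'n) \<times> (real^'m) \<Rightarrow> real^'p"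
  assumes derf: "\<And>z. (f has_derivative blinfun_apply (f' z)) (at z)" and contf: "continuous_on UNIV f'"
    and derg: "\<And>z. (g has_derivative blinfun_apply (g' z)) (at z)" and contg: "continuous_on UNIV g'"
    and y: "y \<in> feas_map g xb" and rs: "robinson_stable_dir g xb y u"
    and v: "v \<in> lin_cone g xb y u" and "0 < e"
  shows "\<forall>\<^sub>F t in at_right 0.
    value_fun f g (xb + t *\<^sub>R u) \<le> ereal (f (xb, y) + t * (f' (xb, y) (u, v) + e))"
proof -
  let ?F = "at_right (0::real)" and ?z = "(xb, y)"
  have gcont: "continuous_on UNIV g"
    using has_derivative_continuous[OF derg] by (simp add: continuous_at_imp_continuous_on)
  have "((\<lambda>t. xb + t *\<^sub>R u) \<longlongrightarrow> xb + 0 *\<^sub>R u) ?F" by (intro tendsto_intros at_right_0_facts)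
  then have x: "((\<lambda>t. xb + t *\<^sub>R u) \<longlongrightarrow> xb) ?F" by simp
  have "((\<lambda>t. y + t *\<^sub>R v) \<longlongrightarrow> y + 0 *\<^sub>R v) ?F" by (intro tendsto_intros at_right_0_facts)
  then have yv: "((\<lambda>t. y + t *\<^sub>R v) \<longlongrightarrow> y) ?F" by simp
  have zv: "((\<lambda>t. (xb + t *\<^sub>R u, y + t *\<^sub>R v)) \<longlongrightarrow> ?z) ?F" by (intro tendsto_Pair x yv)
  have "((\<lambda>t. ((xb + t *\<^sub>R u, y + t *\<^sub>R v) - ?z) /\<^sub>R t) \<longlongrightarrow> (u, v)) ?F"
    by (rule tendsto_eventually) (use at_right_0_facts(2) in eventually_elim, simp)
  from cont_diff_quotient_tendsto[OF derg contg zv tendsto_const this]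
  have quot: "((\<lambda>t. (g (xb + t *\<^sub>R u, y + t *\<^sub>R v) $ i - g ?z $ i) / t) \<longlongrightarrow> g' ?z (u, v) $ i) ?F" for i
    by (drule_tac tendsto_vec_nth[of _ _ _ i]) (simp add: divide_inverse mult.commute)
  have viol: "((\<lambda>t. max 0 (g (xb + t *\<^sub>R u, y + t *\<^sub>R v) $ i) / t) \<longlongrightarrow> 0) ?F" for i
  proof (cases "g ?z $ i = 0")
    case True
    have "gradient (\<lambda>z. g z $ i) ?z \<bullet> (u, v) = g' ?z (u, v) $ i"
      by (intro gradient_inner has_derivative_vec_nth_comp derg)
    then have "g' ?z (u, v) $ i \<le> 0" using v True by (auto simp: lin_cone_def active_set_def)
    with quot[of i] True at_right_0_facts(2) show ?thesis by (intro violation_tendsto_0) auto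
  next
    case False
    then have "g ?z $ i < 0" using y by (simp add: feas_map_def order.strict_iff_order)
    moreover have "((\<lambda>t. g (xb + t *\<^sub>R u, y + t *\<^sub>R v) $ i) \<longlongrightarrow> g ?z $ i) ?F"
      by (intro tendsto_vec_nth isCont_tendsto_compose[OF has_derivative_continuous[OF derg]] zv)
    ultimately show ?thesis using order_tendstoD(2) by (intro violation_tendsto_0') blast
  qed
  obtain w where w: "\<forall>\<^sub>F t in ?F. w t \<in> feas_map g (xb + t *\<^sub>R u)"
    and w0: "((\<lambda>t. (w t - (y + t *\<^sub>R v)) /\<^sub>R t) \<longlongrightarrow> 0) ?F"
    using robinson_stable_correction[OF rs gcont at_right_0_facts(1,3) yv at_right_0_facts(2) viol] by blast
  have "((\<lambda>t. t *\<^sub>R ((w t - (y + t *\<^sub>R v)) /\<^sub>R t) + (y + t *\<^sub>R v)) \<longlongrightarrow> 0 *\<^sub>R 0 + y) ?F"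
    by (intro tendsto_add tendsto_scaleR w0 yv at_right_0_facts)
  then have "((\<lambda>t. t *\<^sub>R ((w t - (y + t *\<^sub>R v)) /\<^sub>R t) + (y + t *\<^sub>R v)) \<longlongrightarrow> y) ?F" by simp
  then have "(w \<longlongrightarrow> y) ?F"
    by (rule Lim_transform_eventually) (use at_right_0_facts(2) in eventually_elim, simp)
  then have zw: "((\<lambda>t. (xb + t *\<^sub>R u, w t)) \<longlongrightarrow> ?z) ?F" by (intro tendsto_Pair x)
  have "((\<lambda>t. (u, v + (w t - (y + t *\<^sub>R v)) /\<^sub>R t)) \<longlongrightarrow> (u, v + 0)) ?F"
    by (intro tendsto_intros w0)
  then have "((\<lambda>t. (u, v + (w t - (y + t *\<^sub>R v)) /\<^sub>R t)) \<longlongrightarrow> (u, v)) ?F" by simp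
  then have "((\<lambda>t. ((xb + t *\<^sub>R u, w t) - ?z) /\<^sub>R t) \<longlongrightarrow> (u, v)) ?F"
    by (rule Lim_transform_eventually)
      (use at_right_0_facts(2) in eventually_elim, simp add: scaleR_diff_right scaleR_add_right)
  from cont_diff_quotient_tendsto[OF derf contf zw tendsto_const this]
  have "((\<lambda>t. (f (xb + t *\<^sub>R u, w t) - f ?z) / t) \<longlongrightarrow> f' ?z (u, v)) ?F"
    by (simp add: divide_inverse mult.commute)
  then have "\<forall>\<^sub>F t in ?F. (f (xb + t *\<^sub>R u, w t) - f ?z) / t < f' ?z (u, v) + e"
    using \<open>0 < e\<close> by (intro order_tendstoD(2)) auto
  with w at_right_0_facts(2) show ?thesis
  proof eventually_elim
    case (elim t)
    then have "f (xb + t *\<^sub>R u, w t) \<le> f ?z + t * (f' ?z (u, v) + e)"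
      by (simp add: field_simps)
    with value_fun_le[OF elim(1), of f] show ?case by (meson ereal_less_eq(3) order_trans)
  qed
qed

text \<open>The two inner problems are a linear program in \<open>v\<close> and its dual. The lower
  bound \<open>p\<close> is supplied in use by the directional derivative of the value
  function.\<close>

lemma linearized_problem_duality:
  fixes g :: "(real^'n) \<times> (real^'m) \<Rightarrow> real^'p"
  assumes derf: "(f has_derivative f') (at (xb, y))" and derg: "(g has_derivative g') (at (xb, y))"
    and y: "y \<in> feas_map g xb" and v0: "v0 \<in> lin_cone g xb y u"
    and below: "\<And>v. v \<in> lin_cone g xb y u \<Longrightarrow> p \<le> f' (u, v)"
  shows "\<exists>d. is_minimum d ((\<lambda>v. gradient f (xb, y) \<bullet> (u, v)) ` lin_cone g xb y u) \<and>
    is_maximum d ((\<lambda>l. gradient (\<lambda>x. lagrangian f g x y l) xb \<bullet> u) ` multipliers f g xb y)"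
proof -
  define I where "I = active_set g xb y"
  define b where "b = (\<lambda>i. gradient (\<lambda>y'. g (xb, y') $ i) y)"
  define c where "c = gradient (\<lambda>y'. f (xb, y')) y"
  define A where "A = (\<lambda>i. g' (u, 0) $ i)"
  have lf: "linear f'" and lg: "linear g'" using derf derg by (auto intro: has_derivative_linear)
  have b: "b i \<bullet> v = g' (0, v) $ i" for i v
    unfolding b_def by (intro gradient_section_snd[where h = "\<lambda>z. g z $ i"] has_derivative_vec_nth_comp derg)
  have c: "c \<bullet> v = f' (0, v)" for v
    unfolding c_def by (intro gradient_section_snd derf)
  have splitf: "f' (u, v) = f' (u, 0) + c \<bullet> v" for v
    using linear_add[OF lf, of "(u, 0)" "(0, v)"] by (simp add: c)
  have splitg: "g' (u, v) $ i = A i + b i \<bullet> v" for v i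
    using linear_add[OF lg, of "(u, 0)" "(0, v)"] by (simp add: A_def b)
  have cone: "v \<in> lin_cone g xb y u \<longleftrightarrow> (\<forall>i\<in>I. b i \<bullet> v \<le> - A i)" for v
  proof -
    have "gradient (\<lambda>z. g z $ i) (xb, y) \<bullet> (u, v) = A i + b i \<bullet> v" for i
      using gradient_inner[OF has_derivative_vec_nth_comp[OF derg], of i "(u, v)"] splitg[of v i] by simp
    then show ?thesis by (simp add: lin_cone_def I_def le_minus_iff add.commute) (smt (verit))
  qed
  have obj: "gradient f (xb, y) \<bullet> (u, v) = f' (u, 0) + c \<bullet> v" for v
    unfolding gradient_inner[OF derf] by (rule splitf)
  have derL: "((\<lambda>z. f z + g z \<bullet> l) has_derivative (\<lambda>w. f' w + g' w \<bullet> l)) (at (xb, y))" for l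
    by (intro has_derivative_add derf has_derivative_inner_left derg)
  have ip: "x \<bullet> l = (\<Sum>i\<in>UNIV. l $ i * x $ i)" for x l :: "real^'p"
    by (simp add: inner_vec_def mult.commute)
  have Lx: "gradient (\<lambda>x. lagrangian f g x y l) xb \<bullet> u = f' (u, 0) + (\<Sum>i\<in>UNIV. l $ i * A i)" for l
    using gradient_section_fst[OF derL, of l u]
    by (simp add: lagrangian_def A_def ip)
  have Ly: "gradient (\<lambda>y'. lagrangian f g xb y' l) y = c + (\<Sum>i\<in>UNIV. l $ i *\<^sub>R b i)" for l
  proof (rule vector_eq_rdot[THEN iffD1], rule allI)
    fix v
    show "gradient (\<lambda>y'. lagrangian f g xb y' l) y \<bullet> v = (c + (\<Sum>i\<in>UNIV. l $ i *\<^sub>R b i)) \<bullet> v"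
      using gradient_section_snd[OF derL, of l v]
      by (simp add: lagrangian_def ip inner_add_left inner_sum_left b c)
  qed
  \<comment> \<open>All summands of the vanishing product of constraints and multipliers have one
    sign, so each of them is zero.\<close>
  have compl: "l $ i = 0" if "l \<in> multipliers f g xb y" "i \<notin> I" for l i
  proof -
    have "(\<Sum>j\<in>UNIV. g (xb, y) $ j * l $ j) = 0" using that(1) by (simp add: multipliers_def inner_vec_def)
    moreover have "g (xb, y) $ j * l $ j \<le> 0" for j
      using that(1) y by (simp add: multipliers_def feas_map_def mult_nonpos_nonneg)
    ultimately have "g (xb, y) $ i * l $ i = 0"
      using sum_nonneg_eq_0_iff[of UNIV "\<lambda>j. - (g (xb, y) $ j * l $ j)"] by (simp add: sum_negf)
    then show ?thesis using that(2) by (simp add: I_def active_set_def)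
  qed
  have weak: "(\<Sum>i\<in>UNIV. l $ i * A i) \<le> c \<bullet> v"
    if l: "l \<in> multipliers f g xb y" and v: "v \<in> lin_cone g xb y u" for l v
  proof -
    have "0 = (c + (\<Sum>i\<in>UNIV. l $ i *\<^sub>R b i)) \<bullet> v" using l Ly by (simp add: multipliers_def)
    also have "\<dots> = c \<bullet> v + (\<Sum>i\<in>UNIV. l $ i * (b i \<bullet> v))" by (simp add: inner_add_left inner_sum_left)
    also have "(\<Sum>i\<in>UNIV. l $ i * (b i \<bullet> v)) \<le> (\<Sum>i\<in>UNIV. l $ i * - A i)"
    proof (rule sum_mono)
      fix i
      show "l $ i * (b i \<bullet> v) \<le> l $ i * - A i"
      proof (cases "i \<in> I")
        case True
        then show ?thesis using v l by (intro mult_left_mono) (auto simp: cone multipliers_def)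
      qed (simp add: compl[OF l])
    qed
    finally show ?thesis by (simp add: sum_negf)
  qed
  have fin: "finite I" by simp
  have feas0: "\<forall>i\<in>I. b i \<bullet> v0 \<le> - A i" using v0 by (simp add: cone)
  have below0: "p - f' (u, 0) \<le> c \<bullet> v" if "\<forall>i\<in>I. b i \<bullet> v \<le> - A i" for v
    using below[of v] that splitf[of v] by (simp add: cone)
  obtain v l where v: "\<forall>i\<in>I. b i \<bullet> v \<le> - A i"
    and l: "\<forall>i. 0 \<le> l i" "\<forall>i. i \<notin> I \<longrightarrow> l i = 0" "c + (\<Sum>i\<in>I. l i *\<^sub>R b i) = 0"
    and opt: "c \<bullet> v = - (\<Sum>i\<in>I. l i * - A i)"
    by (rule lp_duality[of I b v0 "\<lambda>i. - A i" "p - f' (u, 0)" c, OF fin feas0 below0])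
  have vL: "v \<in> lin_cone g xb y u" using v by (simp add: cone)
  have ext: "(\<Sum>i\<in>UNIV. h i) = (\<Sum>i\<in>I. h i)" if "\<And>i. i \<notin> I \<Longrightarrow> h i = 0" for h :: "'p \<Rightarrow> 'b::comm_monoid_add"
    using that by (intro sum.mono_neutral_right) auto
  have "g (xb, y) \<bullet> (\<chi> i. l i) = 0"
    unfolding ip by (rule sum.neutral) (use l(2) in \<open>auto simp: I_def active_set_def\<close>)
  then have lM: "(\<chi> i. l i) \<in> multipliers f g xb y"
    using l by (simp add: multipliers_def Ly ext)
  have eq: "(\<Sum>i\<in>UNIV. (\<chi> i. l i) $ i * A i) = c \<bullet> v"
    using l(2) opt by (simp add: ext sum_negf)
  have "is_minimum (f' (u, 0) + c \<bullet> v) ((\<lambda>v. gradient f (xb, y) \<bullet> (u, v)) ` lin_cone g xb y u)"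
    unfolding is_minimum_def obj using vL weak[OF lM] eq by auto
  moreover have "is_maximum (f' (u, 0) + c \<bullet> v)
      ((\<lambda>l. gradient (\<lambda>x. lagrangian f g x y l) xb \<bullet> u) ` multipliers f g xb y)"
    unfolding is_maximum_def Lx using weak[OF _ vL] lM eq by (auto intro!: image_eqI[OF _ lM])
  ultimately show ?thesis by blast
qed

lemma cont_diff_obtain:
  assumes "cont_diff h"
  obtains h' where "\<And>z. (h has_derivative blinfun_apply (h' z)) (at z)" "continuous_on UNIV h'"
    "continuous_on UNIV h"
proof -
  obtain h' where h': "\<forall>z. (h has_derivative blinfun_apply (h' z)) (at z)" "continuous_on UNIV h'"
    using assms unfolding cont_diff_def by blast
  moreover have "continuous_on UNIV h"
    using has_derivative_continuous[OF h'(1)[rule_format]] by (simp add: continuous_at_imp_continuous_on)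
  ultimately show ?thesis using that by blast
qed

text \<open>Each \<open>w k\<close> is feasible at \<open>xb\<close>, hence costs at least the
  optimal value there; strict differentiability gives the first-order cost of passing from
  \<open>w k\<close> to the perturbed solution.\<close>

lemma value_fun_lower_bound:
  fixes g :: "(real^'n) \<times> (real^'m) \<Rightarrow> real^'p"
  assumes derf: "\<And>z. (f has_derivative blinfun_apply (f' z)) (at z)" and contf: "continuous_on UNIV f'"
    and derg: "\<And>z. (g has_derivative blinfun_apply (g' z)) (at z)" and contg: "continuous_on UNIV g'"
    and yb: "yb \<in> sol_map f g xb" and rcr: "rcr_regular g xb yb" and rs: "robinson_stable_dir g xb yb u"
    and t: "\<And>k. 0 < t k" "t \<longlonglongrightarrow> 0" and y: "y \<longlonglongrightarrow> yb"
    and sol: "\<And>k. y k \<in> sol_map f g (xb + t k *\<^sub>R u)"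
  obtains r v where "strict_mono r" "v \<in> lin_cone g xb yb u"
    "\<forall>e>0. \<forall>\<^sub>F k in sequentially. value_fun f g xb + ereal (t (r k) * (f' (xb, yb) (u, v) - e))
      \<le> value_fun f g (xb + t (r k) *\<^sub>R u)"
proof -
  have ybf: "yb \<in> feas_map g xb" using yb by (simp add: sol_map_def)
  have yf: "y k \<in> feas_map g (xb + t k *\<^sub>R u)" for k using sol[of k] by (simp add: sol_map_def)
  obtain r v w where r: "strict_mono r" and v: "v \<in> lin_cone g xb yb u"
    and w: "\<forall>\<^sub>F k in sequentially. w k \<in> feas_map g xb"
    and lim: "(\<lambda>k. (y (r k) - w k) /\<^sub>R t (r k)) \<longlonglongrightarrow> v"
    by (rule feasible_increment_limit[OF derg contg ybf rcr rs t tendsto_const y yf])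
  have tr: "(\<lambda>k. t (r k)) \<longlonglongrightarrow> 0" and yr: "(\<lambda>k. y (r k)) \<longlonglongrightarrow> yb"
    using LIMSEQ_subseq_LIMSEQ[OF _ r] t(2) y by (auto simp: o_def)
  have "(\<lambda>k. xb + t (r k) *\<^sub>R u) \<longlonglongrightarrow> xb + 0 *\<^sub>R u" by (intro tendsto_intros tr)
  then have xr: "(\<lambda>k. xb + t (r k) *\<^sub>R u) \<longlonglongrightarrow> xb" by simp
  have pos: "t (r k) \<noteq> 0" for k using t(1)[of "r k"] by simp
  have "(\<lambda>k. y (r k) - t (r k) *\<^sub>R ((y (r k) - w k) /\<^sub>R t (r k))) \<longlonglongrightarrow> yb - 0 *\<^sub>R v"
    by (intro tendsto_intros yr tr lim)
  then have wr: "w \<longlonglongrightarrow> yb" using pos by simp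
  have "(\<lambda>k. (u, (y (r k) - w k) /\<^sub>R t (r k))) \<longlonglongrightarrow> (u, v)" by (intro tendsto_intros lim)
  then have "(\<lambda>k. ((xb + t (r k) *\<^sub>R u, y (r k)) - (xb, w k)) /\<^sub>R t (r k)) \<longlonglongrightarrow> (u, v)"
    using pos by simp
  from cont_diff_quotient_tendsto[OF derf contf tendsto_Pair[OF xr yr] tendsto_Pair[OF tendsto_const wr] this]
  have quot: "(\<lambda>k. (f (xb + t (r k) *\<^sub>R u, y (r k)) - f (xb, w k)) / t (r k)) \<longlonglongrightarrow> f' (xb, yb) (u, v)"
    by (simp add: divide_inverse mult.commute)
  have "\<forall>\<^sub>F k in sequentially. value_fun f g xb + ereal (t (r k) * (f' (xb, yb) (u, v) - e))
      \<le> value_fun f g (xb + t (r k) *\<^sub>R u)" if "0 < e" for e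
  proof -
    have "\<forall>\<^sub>F k in sequentially. f' (xb, yb) (u, v) - e < (f (xb + t (r k) *\<^sub>R u, y (r k)) - f (xb, w k)) / t (r k)"
      using that by (intro order_tendstoD(1)[OF quot]) simp
    with w show ?thesis
    proof eventually_elim
      case (elim k)
      have "f (xb, yb) \<le> f (xb, w k)" using yb elim(1) by (simp add: sol_map_def)
      moreover have "t (r k) * (f' (xb, yb) (u, v) - e) < f (xb + t (r k) *\<^sub>R u, y (r k)) - f (xb, w k)"
        using elim(2) t(1)[of "r k"] by (simp add: pos_less_divide_eq mult.commute)
      ultimately show ?case by (simp add: value_fun_eq[OF yb] value_fun_eq[OF sol])
    qed
  qed
  then show ?thesis using that r v by blast
qed

text \<open>Upper semicontinuity along the ray does two things: it makes restricted inf-compactness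
  applicable, and it passes optimality to the cluster point.\<close>

lemma solution_cluster_point:
  fixes g :: "(real^'n) \<times> (real^'m) \<Rightarrow> real^'p"
  assumes f: "continuous_on UNIV f" and g: "continuous_on UNIV g"
    and ric: "restricted_inf_compact_dir f g xb u"
    and rs: "\<And>y. y \<in> sol_map f g xb \<Longrightarrow> robinson_stable_dir g xb y u"
    and t: "\<And>k. 0 < t k" "t \<longlonglongrightarrow> 0"
  obtains r y yb where "strict_mono r" "yb \<in> sol_map f g xb" "y \<longlonglongrightarrow> yb"
    "\<And>k. y k \<in> sol_map f g (xb + t (r k) *\<^sub>R u)"
proof -
  have fin: "\<bar>value_fun f g xb\<bar> \<noteq> \<infinity>" using ric by (simp add: restricted_inf_compact_dir_def)
  obtain \<Omega> \<epsilon> \<delta> where \<Omega>: "compact \<Omega>" and pos: "0 < \<epsilon>" "0 < \<delta>"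
    and ric': "\<forall>z\<in>dir_nbhd \<epsilon> \<delta> u. value_fun f g (xb + z) < value_fun f g xb + ereal \<epsilon> \<longrightarrow>
      sol_map f g (xb + z) \<inter> \<Omega> \<noteq> {}"
    using ric unfolding restricted_inf_compact_dir_def by (elim conjE exE) (rule that)
  have ne: "sol_map f g (xb + z) \<inter> \<Omega> \<noteq> {}"
    if "z \<in> dir_nbhd \<epsilon> \<delta> u" "value_fun f g (xb + z) < value_fun f g xb + ereal \<epsilon>" for z
    using ric' that by blast
  have cont: "isCont h z" if "continuous_on UNIV h" for h :: "(real^'n) \<times> (real^'m) \<Rightarrow> 'b::topological_space" and z
    using that continuous_on_eq_continuous_at[OF open_UNIV, of h] by blast
  \<comment> \<open>The zero perturbation belongs to the directional neighbourhood, and finiteness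
    of the value gives the strict inequality; this yields a solution at \<open>xb\<close>
    itself.\<close>
  have "sol_map f g (xb + 0) \<inter> \<Omega> \<noteq> {}"
    using pos fin by (intro ne) (auto simp: dir_nbhd_def)
  then obtain y0 where y0: "y0 \<in> sol_map f g xb" by auto
  then have y0f: "y0 \<in> feas_map g xb" by (simp add: sol_map_def)
  have t_right: "filterlim t (at_right 0) sequentially"
    using t by (intro tendsto_imp_filterlim_at_right) auto
  have upper: "\<forall>\<^sub>F k in sequentially. value_fun f g (xb + t k *\<^sub>R u) < ereal (f (xb, y0) + e)" if "0 < e" for e
    using filterlim_iff[THEN iffD1, OF t_right] value_fun_upper_semicont[OF f g y0f rs[OF y0] that] by blast
  have "\<forall>\<^sub>F k in sequentially. t k *\<^sub>R u \<in> dir_nbhd \<epsilon> \<delta> u"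
    using t pos by (intro eventually_dir_nbhd) (simp_all add: less_imp_le)
  with upper[OF pos(1)] have "\<forall>\<^sub>F k in sequentially. sol_map f g (xb + t k *\<^sub>R u) \<inter> \<Omega> \<noteq> {}"
    by eventually_elim (use ne value_fun_eq[OF y0] in auto)
  then obtain N where N: "\<And>k. N \<le> k \<Longrightarrow> sol_map f g (xb + t k *\<^sub>R u) \<inter> \<Omega> \<noteq> {}"
    unfolding eventually_sequentially by blast
  then have "\<forall>k. \<exists>y. y \<in> sol_map f g (xb + t (k + N) *\<^sub>R u) \<and> y \<in> \<Omega>" by (meson disjoint_iff le_add2)
  then obtain y where y: "\<And>k. y k \<in> sol_map f g (xb + t (k + N) *\<^sub>R u)" "\<And>k. y k \<in> \<Omega>" by metis
  obtain yb s where s: "strict_mono s" "(y \<circ> s) \<longlonglongrightarrow> yb"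
    using \<Omega> y(2) unfolding compact_def by metis
  \<comment> \<open>The shift by \<open>N\<close> accounts for the discarded initial terms, where
    solutions in \<open>\<Omega>\<close> may be missing.\<close>
  define r where "r = (\<lambda>k. s k + N)"
  have r: "strict_mono r" using s(1) by (simp add: r_def strict_mono_def)
  have ys: "(\<lambda>k. y (s k)) \<longlonglongrightarrow> yb" using s(2) by (simp add: o_def)
  have sol: "y (s k) \<in> sol_map f g (xb + t (r k) *\<^sub>R u)" for k using y(1) by (simp add: r_def)
  have tr: "(\<lambda>k. t (r k)) \<longlonglongrightarrow> 0" using LIMSEQ_subseq_LIMSEQ[OF t(2) r] by (simp add: o_def)
  have "(\<lambda>k. xb + t (r k) *\<^sub>R u) \<longlonglongrightarrow> xb + 0 *\<^sub>R u" by (intro tendsto_intros tr)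
  then have zr: "(\<lambda>k. (xb + t (r k) *\<^sub>R u, y (s k))) \<longlonglongrightarrow> (xb, yb)" using ys by (intro tendsto_Pair) simp_all
  have "g (xb, yb) $ i \<le> 0" for i
  proof (rule LIMSEQ_le_const2)
    show "(\<lambda>k. g (xb + t (r k) *\<^sub>R u, y (s k)) $ i) \<longlonglongrightarrow> g (xb, yb) $ i"
      by (intro tendsto_vec_nth isCont_tendsto_compose[OF cont[OF g]] zr)
    show "\<exists>N. \<forall>n\<ge>N. g (xb + t (r n) *\<^sub>R u, y (s n)) $ i \<le> 0"
      using sol by (auto simp: sol_map_def feas_map_def)
  qed
  then have feas: "yb \<in> feas_map g xb" by (simp add: feas_map_def)
  have "f (xb, yb) \<le> f (xb, y0) + e" if "0 < e" for e
  proof (rule tendsto_upperbound)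
    show "(\<lambda>k. f (xb + t (r k) *\<^sub>R u, y (s k))) \<longlonglongrightarrow> f (xb, yb)"
      by (intro isCont_tendsto_compose[OF cont[OF f]] zr)
    have "\<forall>\<^sub>F k in sequentially. value_fun f g (xb + t (r k) *\<^sub>R u) < ereal (f (xb, y0) + e)"
      using upper[OF that] r by (rule eventually_subseq[rotated])
    then show "\<forall>\<^sub>F k in sequentially. f (xb + t (r k) *\<^sub>R u, y (s k)) \<le> f (xb, y0) + e"
      by eventually_elim (simp add: value_fun_eq[OF sol])
  qed simp
  then have "f (xb, yb) \<le> f (xb, y0)" by (rule field_le_epsilon)
  then have "yb \<in> sol_map f g xb" using y0 feas by (auto simp: sol_map_def intro: order_trans)
  then show ?thesis using that r ys sol by blast
qed

text \<open>\<open>\<phi> y\<close> and \<open>\<psi> y\<close> are the inner optimal values. Since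
  \<open>is_minimum\<close> includes attainment, the outer clauses also contain that the directional
  solution set is nonempty.\<close>

theorem proposition4p3:
  fixes f :: "(real^'n) \<times> (real^'m) \<Rightarrow> real"
    and g :: "(real^'n) \<times> (real^'m) \<Rightarrow> real^'p"
    and xb u :: "real^'n"
  assumes "cont_diff f"
    and "cont_diff g"
    and "\<forall>y\<in>sol_map f g xb. rcr_regular g xb y"
    and "restricted_inf_compact_dir f g xb u"
    and "\<forall>y\<in>sol_map f g xb. robinson_stable_dir g xb y u"
  shows "\<exists>d \<phi> \<psi>.
    has_dir_derivative (value_fun f g) d xb u \<and>
    (\<forall>y\<in>dir_sol_set f g xb u.
       is_minimum (\<phi> y) ((\<lambda>v. gradient f (xb, y) \<bullet> (u, v)) ` lin_cone g xb y u)) \<and>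
    is_minimum d (\<phi> ` dir_sol_set f g xb u) \<and>
    (\<forall>y\<in>dir_sol_set f g xb u.
       is_maximum (\<psi> y)
         ((\<lambda>l. gradient (\<lambda>x. lagrangian f g x y l) xb \<bullet> u) ` multipliers f g xb y)) \<and>
    is_minimum d (\<psi> ` dir_sol_set f g xb u)"
proof -
  obtain f' where f': "\<And>z. (f has_derivative blinfun_apply (f' z)) (at z)" "continuous_on UNIV f'"
    and cf: "continuous_on UNIV f" using assms(1) by (rule cont_diff_obtain) (rule that)
  obtain g' where g': "\<And>z. (g has_derivative blinfun_apply (g' z)) (at z)" "continuous_on UNIV g'"
    and cg: "continuous_on UNIV g" using assms(2) by (rule cont_diff_obtain) (rule that)
  let ?V = "value_fun f g"
  define S where "S = sol_map f g xb"
  define D where "D = dir_sol_set f g xb u"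
  define L where "L = (\<lambda>y. lin_cone g xb y u)"
  define F where "F = (\<lambda>y v. f' (xb, y) (u, v))"
  have DS: "y \<in> S" if "y \<in> D" for y using that by (simp add: D_def S_def dir_sol_set_def)
  have Sf: "y \<in> feas_map g xb" if "y \<in> S" for y using that by (simp add: S_def sol_map_def)
  have rcr: "rcr_regular g xb y" and rs: "robinson_stable_dir g xb y u" if "y \<in> S" for y
    using assms(3,5) that by (auto simp: S_def)
  have grad: "gradient f (xb, y) \<bullet> (u, v) = F y v" for y v
    unfolding F_def by (rule gradient_inner[OF f'(1)])
  obtain V0 where V0: "?V xb = ereal V0"
    using assms(4) unfolding restricted_inf_compact_dir_def by (cases "?V xb") auto
  have upper: "\<forall>\<^sub>F t in at_right 0. ?V (xb + t *\<^sub>R u) \<le> ereal (V0 + t * (F y v + e))"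
    if y: "y \<in> S" and v: "v \<in> L y" and e: "0 < e" for y v e
  proof -
    have "f (xb, y) = V0" using value_fun_eq[of y f g xb] y V0 by (simp add: S_def)
    then show ?thesis
      using value_fun_upper_bound[OF f' g' Sf[OF y] rs[OF y] v[unfolded L_def] e] by (simp add: F_def)
  qed
  \<comment> \<open>Arbitrary step sequences are needed: one use produces \<open>d\<close>, the
    other refutes a failure of the lower estimate.\<close>
  have lower: "\<exists>r y v. strict_mono r \<and> y \<in> D \<and> v \<in> L y \<and>
      (\<forall>e>0. \<forall>\<^sub>F k in sequentially. ereal (V0 + t (r k) * (F y v - e)) \<le> ?V (xb + t (r k) *\<^sub>R u))"
    if t: "\<And>k. 0 < t k" "t \<longlonglongrightarrow> 0" for t :: "nat \<Rightarrow> real"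
  proof -
    obtain r y yb where r: "strict_mono r" and yb: "yb \<in> sol_map f g xb" and y: "y \<longlonglongrightarrow> yb"
      and sol: "\<And>k. y k \<in> sol_map f g (xb + t (r k) *\<^sub>R u)"
      by (rule solution_cluster_point[OF cf cg assms(4) _ t]) (use assms(5) in blast, rule that)
    have tr: "\<And>k. 0 < t (r k)" "(\<lambda>k. t (r k)) \<longlonglongrightarrow> 0"
      using t(1) LIMSEQ_subseq_LIMSEQ[OF t(2) r] by (simp_all add: o_def)
    have ybS: "yb \<in> S" using yb by (simp add: S_def)
    have "yb \<in> D"
      unfolding D_def dir_sol_set_def using yb tr y sol
      by (intro CollectI conjI exI[of _ "\<lambda>k. t (r k)"] exI[of _ "\<lambda>_. u"] exI[of _ y]) auto
    moreover obtain s v where "strict_mono s" "v \<in> lin_cone g xb yb u"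
      "\<forall>e>0. \<forall>\<^sub>F k in sequentially. ?V xb + ereal (t (r (s k)) * (f' (xb, yb) (u, v) - e))
        \<le> ?V (xb + t (r (s k)) *\<^sub>R u)"
      using value_fun_lower_bound[OF f' g' yb rcr[OF ybS] rs[OF ybS] tr y sol] by blast
    ultimately show ?thesis
      using strict_mono_o[OF r] by (intro exI[of _ "r \<circ> s"]) (auto simp: L_def F_def V0)
  qed
  have right: "filterlim t (at_right 0) sequentially"
    if "\<And>k. 0 < t k" "t \<longlonglongrightarrow> 0" for t :: "nat \<Rightarrow> real"
    using that by (intro tendsto_imp_filterlim_at_right) auto
  \<comment> \<open>Any positive null sequence would do for finding \<open>y0\<close> and
    \<open>v0\<close>; \<open>d_le\<close> shows that the resulting \<open>d\<close> does not depend
    on the choice.\<close>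
  have inv0: "\<And>k. 0 < inverse (real (Suc k))" "(\<lambda>k. inverse (real (Suc k))) \<longlonglongrightarrow> 0"
    by (simp, rule LIMSEQ_inverse_real_of_nat)
  obtain r0 y0 v0 where r0: "strict_mono r0" and y0: "y0 \<in> D" and v0: "v0 \<in> L y0"
    and low0: "\<And>e. 0 < e \<Longrightarrow> \<forall>\<^sub>F k in sequentially.
      ereal (V0 + inverse (real (Suc (r0 k))) * (F y0 v0 - e)) \<le> ?V (xb + inverse (real (Suc (r0 k))) *\<^sub>R u)"
    using lower[OF inv0] by blast
  define d where "d = F y0 v0"
  \<comment> \<open>The lower estimate for \<open>y0\<close>, \<open>v0\<close> and the upper
    estimate for \<open>y\<close>, \<open>v\<close> hold at a common small step, by which both are
    divided. The result covers all of \<open>S\<close>, not only \<open>D\<close>.\<close>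
  have d_le: "d \<le> F y v" if y: "y \<in> S" and v: "v \<in> L y" for y v
  proof (rule field_le_epsilon)
    fix e :: real assume "0 < e"
    then have e: "0 < e / 2" by simp
    have lim: "(\<lambda>k. inverse (real (Suc (r0 k)))) \<longlonglongrightarrow> 0"
      using LIMSEQ_subseq_LIMSEQ[OF inv0(2) r0] by (simp add: o_def)
    have "filterlim (\<lambda>k. inverse (real (Suc (r0 k)))) (at_right 0) sequentially"
      by (rule right[OF _ lim]) simp
    from filterlim_iff[THEN iffD1, OF this] upper[OF y v e]
    have "\<forall>\<^sub>F k in sequentially. ?V (xb + inverse (real (Suc (r0 k))) *\<^sub>R u)
        \<le> ereal (V0 + inverse (real (Suc (r0 k))) * (F y v + e / 2))" by blast
    from eventually_happens'[OF sequentially_bot eventually_conj[OF this low0[OF e]]]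
    obtain k where "ereal (V0 + inverse (real (Suc (r0 k))) * (d - e / 2))
        \<le> ereal (V0 + inverse (real (Suc (r0 k))) * (F y v + e / 2))"
      unfolding d_def using order_trans by blast
    then have "d - e / 2 \<le> F y v + e / 2" by (simp del: of_nat_Suc)
    then show "d \<le> F y v + e" by simp
  qed
  \<comment> \<open>From subsequences to all small \<open>t\<close>: steps at which the estimate
    fails would form a null sequence, and the pair that \<open>lower\<close> finds along it has
    \<open>F y v\<close> at least \<open>d\<close>.\<close>
  have lowd: "\<forall>\<^sub>F t in at_right 0. ereal (V0 + t * (d - e)) \<le> ?V (xb + t *\<^sub>R u)" if e: "0 < e" for e
  proof (rule ccontr)
    assume not: "\<not> ?thesis"
    have "\<exists>t. 0 < t \<and> t < inverse (real (Suc k)) \<and> \<not> ereal (V0 + t * (d - e)) \<le> ?V (xb + t *\<^sub>R u)" for k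
      using not inv0(1)[of k] unfolding eventually_at_right_field by blast
    then obtain t where t: "\<And>k. 0 < t k" "\<And>k. t k < inverse (real (Suc k))"
      and bad: "\<And>k. \<not> ereal (V0 + t k * (d - e)) \<le> ?V (xb + t k *\<^sub>R u)" by metis
    have "t \<longlonglongrightarrow> 0"
      by (rule tendsto_sandwich[OF _ _ tendsto_const inv0(2)]) (auto simp: t less_imp_le simp del: of_nat_Suc)
    from lower[OF t(1) this] obtain r y v where "y \<in> D" "v \<in> L y"
      and "\<forall>e>0. \<forall>\<^sub>F k in sequentially. ereal (V0 + t (r k) * (F y v - e)) \<le> ?V (xb + t (r k) *\<^sub>R u)"
      by blast
    with e have "\<forall>\<^sub>F k in sequentially. ereal (V0 + t (r k) * (F y v - e)) \<le> ?V (xb + t (r k) *\<^sub>R u)" by blast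
    from eventually_happens'[OF sequentially_bot this]
    obtain k where k: "ereal (V0 + t (r k) * (F y v - e)) \<le> ?V (xb + t (r k) *\<^sub>R u)" by blast
    have "d \<le> F y v" using d_le DS \<open>y \<in> D\<close> \<open>v \<in> L y\<close> by blast
    then have "t (r k) * (d - e) \<le> t (r k) * (F y v - e)" using t(1)[of "r k"] by (intro mult_left_mono) auto
    then have "ereal (V0 + t (r k) * (d - e)) \<le> ?V (xb + t (r k) *\<^sub>R u)"
      using k by (meson add_left_mono ereal_less_eq(3) order_trans)
    with bad[of "r k"] show False by blast
  qed
  have near: "\<forall>\<^sub>F t in at_right 0. 0 < t \<and> ereal (V0 + t * (d - e)) \<le> ?V (xb + t *\<^sub>R u) \<and>
      ?V (xb + t *\<^sub>R u) \<le> ereal (V0 + t * (d + e))" if "0 < e" for e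
    using at_right_0_facts(2) lowd[OF that] upper[OF DS[OF y0] v0 that]
    by eventually_elim (simp add: d_def)
  \<comment> \<open>The two bounds in \<open>near\<close> make the perturbed value finite for small
    \<open>t\<close>, so the extended quotient is a real one there.\<close>
  define q where "q = (\<lambda>t. (real_of_ereal (?V (xb + t *\<^sub>R u)) - V0) / t)"
  have quot: "(?V (xb + t *\<^sub>R u) - ?V xb) / ereal t = ereal (q t) \<and> \<bar>q t - d\<bar> \<le> e"
    if t: "0 < t \<and> ereal (V0 + t * (d - e)) \<le> ?V (xb + t *\<^sub>R u) \<and> ?V (xb + t *\<^sub>R u) \<le> ereal (V0 + t * (d + e))"
    for t e
  proof -
    obtain a where a: "?V (xb + t *\<^sub>R u) = ereal a" using t by (cases "?V (xb + t *\<^sub>R u)") auto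
    have "t * (d - e) \<le> a - V0" "a - V0 \<le> t * (d + e)" using t by (simp_all add: a)
    then have "d - e \<le> (a - V0) / t" "(a - V0) / t \<le> d + e"
      using t by (simp_all add: pos_le_divide_eq pos_divide_le_eq mult.commute)
    then show ?thesis using t by (simp add: a V0 q_def abs_le_iff)
  qed
  have "(q \<longlongrightarrow> d) (at_right 0)"
  proof (rule tendstoI)
    fix e :: real assume "0 < e"
    then have "0 < e / 2" by simp
    from near[OF this] show "\<forall>\<^sub>F t in at_right 0. dist (q t) d < e"
      by eventually_elim (use quot \<open>0 < e\<close> in \<open>fastforce simp: dist_real_def\<close>)
  qed
  then have "((\<lambda>t. ereal (q t)) \<longlongrightarrow> ereal d) (at_right 0)" by (rule tendsto_ereal)
  then have deriv: "has_dir_derivative ?V d xb u"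
    unfolding has_dir_derivative_def
  proof (rule Lim_transform_eventually)
    show "\<forall>\<^sub>F t in at_right 0. ereal (q t) = (?V (xb + t *\<^sub>R u) - ?V xb) / ereal t"
      using near[OF zero_less_one] by eventually_elim (use quot in metis)
  qed
  \<comment> \<open>Feasibility of the linear program at each \<open>y\<close> in \<open>D\<close>
    comes from the sequences in the definition of \<open>D\<close>, with their moving directions;
    boundedness is \<open>d_le\<close>.\<close>
  have "\<exists>m. is_minimum m ((\<lambda>v. gradient f (xb, y) \<bullet> (u, v)) ` L y) \<and>
      is_maximum m ((\<lambda>l. gradient (\<lambda>x. lagrangian f g x y l) xb \<bullet> u) ` multipliers f g xb y)"
    if y: "y \<in> D" for y
  proof -
    note yS = DS[OF y]
    obtain t uk yk where t: "\<And>k. 0 < t k" "t \<longlonglongrightarrow> 0" "uk \<longlonglongrightarrow> u" "yk \<longlonglongrightarrow> y"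
      and "\<And>k. yk k \<in> sol_map f g (xb + t k *\<^sub>R uk k)"
      using y unfolding D_def dir_sol_set_def by blast
    then have "yk k \<in> feas_map g (xb + t k *\<^sub>R uk k)" for k by (simp add: sol_map_def)
    from feasible_increment_limit[OF g' Sf[OF yS] rcr[OF yS] rs[OF yS] t this]
    obtain v where "v \<in> L y" unfolding L_def by blast
    then show ?thesis
      using linearized_problem_duality[OF f'(1) g'(1) Sf[OF yS], of v u d] d_le[OF yS] by (simp add: L_def F_def)
  qed
  then obtain \<phi> where \<phi>: "\<And>y. y \<in> D \<Longrightarrow> is_minimum (\<phi> y) ((\<lambda>v. gradient f (xb, y) \<bullet> (u, v)) ` L y)"
    "\<And>y. y \<in> D \<Longrightarrow> is_maximum (\<phi> y)
      ((\<lambda>l. gradient (\<lambda>x. lagrangian f g x y l) xb \<bullet> u) ` multipliers f g xb y)" by metis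
  have \<phi>_ge: "d \<le> \<phi> y" if "y \<in> D" for y
    using \<phi>(1)[OF that] d_le[OF DS[OF that]] by (auto simp: is_minimum_def grad)
  have "\<phi> y0 \<le> d" using \<phi>(1)[OF y0] v0 by (auto simp: is_minimum_def grad d_def)
  with \<phi>_ge[OF y0] have "d = \<phi> y0" by simp
  with \<phi>_ge y0 have "is_minimum d (\<phi> ` D)" by (auto simp: is_minimum_def)
  \<comment> \<open>By duality the two inner values agree, so \<open>\<phi>\<close> also serves as
    the witness for \<open>\<psi>\<close>.\<close>
  with deriv \<phi> show ?thesis unfolding D_def L_def by blast
qed

end
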